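(* In a $4$-dimensional space of signature $s$, let $a_1,\dots,a_6$ and $a_{7i},a_{8i},a_{9i}$ ($i=1,2,3$) be scalars, and let $b_{kl}$ ($k,l=1,2,3$), $b_1,b_2,b_3$ and $c_1,c_2,c_3$ be pseudo-scalars. Let $B_{\alpha\mu\nu}$ be a given (known) rank-$3$ tensor, and consider the following $30$-parameter equation for the components $N_{\alpha\mu\nu}$ of an unknown rank-$3$ tensor $N$: $$\begin{aligned} &a_{1}N_{\alpha\mu\nu}+a_{2}N_{\nu\alpha\mu}+a_{3}N_{\mu\nu\alpha}+a_{4}N_{\alpha\nu\mu}+a_{5}N_{\nu\mu\alpha}+a_{6}N_{\mu\alpha\nu}+\sum_{i=1}^{3}\Big(a_{7i}N^{(i)}_{\mu}g_{\alpha\nu}+a_{8i}N^{(i)}_{\nu}g_{\alpha\mu}+a_{9i}N^{(i)}_{\alpha}g_{\mu\nu}\Big)\\ &+b_{11}M^{(1)}_{\alpha\mu\nu}+b_{12}M^{(1)}_{\nu\alpha\mu}+b_{13}M^{(1)}_{\mu\nu\alpha}+b_{21}M^{(2)}_{\alpha\mu\nu}+b_{22}M^{(2)}_{\nu\alpha\mu}+b_{23}M^{(2)}_{\mu\nu\alpha}+b_{31}M^{(3)}_{\alpha\mu\nu}+b_{32}M^{(3)}_{\nu\alpha\mu}+b_{33}M^{(3)}_{\mu\nu\alpha}\\ &+\varepsilon_{\rho\alpha\mu\nu}\Big(b_{1}N^{(1)\rho}+b_{2}N^{(2)\rho}+b_{3}N^{(3)\rho}\Big)+c_{1}M_{\mu}g_{\alpha\nu}+c_{2}M_{\nu}g_{\alpha\mu}+c_{3}M_{\alpha}g_{\mu\nu}=B_{\alpha\mu\nu}.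 \end{aligned}\qquad(\ast)$$ Let $A$ be the $15\times15$ matrix and $\Gamma$ the $4\times4$ matrix whose entries are the linear combinations of the parameters listed in the context. If both matrices are non-singular, that is, $\det(A)\neq0$ and $\det(\Gamma)\neq0$, then the general and unique solution of $(\ast)$ is $$\begin{aligned} N_{\alpha\mu\nu}=\;&\tilde{\alpha}_{1,1}\hat{B}_{\alpha\mu\nu}+\tilde{\alpha}_{1,2}\hat{B}_{\nu\alpha\mu}+\tilde{\alpha}_{1,3}\hat{B}_{\mu\nu\alpha}+\tilde{\alpha}_{1,4}\hat{B}_{\alpha\nu\mu}+\tilde{\alpha}_{1,5}\hat{B}_{\nu\mu\alpha}+\tilde{\alpha}_{1,6}\hat{B}_{\mu\alpha\nu}\\ &+\tilde{\alpha}_{1,7}\breve{B}_{\alpha\mu\nu}+\tilde{\alpha}_{1,8}\breve{B}_{\mu\nu\alpha}+\tilde{\alpha}_{1,9}\breve{B}_{\nu\alpha\mu}+\tilde{\alpha}_{1,10}\bar{B}_{\alpha\mu\nu}+\tilde{\alpha}_{1,11}\bar{B}_{\mu\nu\alpha}+\tilde{\alpha}_{1,12}\bar{B}_{\nu\alpha\mu}\\ &+\tilde{\alpha}_{1,13}\mathring{B}_{\alpha\mu\nu}+\tilde{\alpha}_{1,14}\mathring{B}_{\mu\nu\alpha}+\tilde{\alpha}_{1,15}\mathring{B}_{\nu\alpha\mu}. \end{aligned}$$ Here $\tilde{\alpha}_{1,k}$ ($k=1,\dots,15$) are the first-row elements of the inverse matrix $A^{-1}$ and $\tilde{\gamma}_{ij}$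 are the elements of the inverse matrix $\Gamma^{-1}$. With the notation $a_{74}:=c_1$, $a_{84}:=c_2$, $a_{94}:=c_3$, the tensors on the right-hand side are $$\hat{B}_{\alpha\mu\nu}=B_{\alpha\mu\nu}-\sum_{i=1}^{4}\sum_{j=1}^{4}\Big(a_{7i}\tilde{\gamma}_{ij}B^{(j)}_{\mu}g_{\alpha\nu}+a_{8i}\tilde{\gamma}_{ij}B^{(j)}_{\nu}g_{\alpha\mu}+a_{9i}\tilde{\gamma}_{ij}B^{(j)}_{\alpha}g_{\mu\nu}\Big)-\varepsilon^{\rho}{}_{\alpha\mu\nu}\sum_{i=1}^{3}\sum_{j=1}^{4}b_{i}\tilde{\gamma}_{ij}B^{(j)}_{\rho},$$ $$\breve{B}_{\alpha\mu\nu}=\varepsilon^{\beta\gamma}{}_{\alpha\mu}\hat{B}_{\beta\gamma\nu}-2(-1)^{s}\sum_{j=1}^{4}\Big[(b_{21}+b_{23}+b_{31}+b_{33})\tilde{\gamma}_{1j}+(b_{11}+b_{13}-b_{31}-b_{33})\tilde{\gamma}_{2j}-(b_{11}+b_{13}+b_{21}+b_{23})\tilde{\gamma}_{3j}\Big]B^{(j)}_{[\alpha}g_{\mu]\nu},$$ $$\bar{B}_{\alpha\mu\nu}=\varepsilon^{\beta\gamma}{}_{\alpha\nu}\hat{B}_{\beta\mu\gamma}-2(-1)^{s}\sum_{j=1}^{4}\Big[(b_{21}+b_{22}+b_{31}+b_{32})\tilde{\gamma}_{1j}+(b_{11}+b_{12}-b_{31}-b_{32})\tilde{\gamma}_{2j}-(b_{11}+b_{12}+b_{21}+b_{22})\tilde{\gamma}_{3j}\Big]B^{(j)}_{[\alpha}g_{\nu]\mu},$$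 $$\mathring{B}_{\alpha\mu\nu}=\varepsilon^{\beta\gamma}{}_{\mu\nu}\hat{B}_{\alpha\beta\gamma}-2(-1)^{s+1}\sum_{j=1}^{4}\Big[(b_{22}+b_{23}+b_{32}+b_{33})\tilde{\gamma}_{1j}+(b_{12}+b_{13}-b_{32}-b_{33})\tilde{\gamma}_{2j}-(b_{22}+b_{23}+b_{12}+b_{13})\tilde{\gamma}_{3j}\Big]B^{(j)}_{[\mu}g_{\nu]\alpha}.$$ The result also holds when $N_{\alpha\mu\nu}$ are the components of a tensor density, or even of a connection, provided $B_{\alpha\mu\nu}$ are of the same kind.
   Context: **Setting.** $\mathcal{M}$ is a $4$-dimensional differentiable manifold endowed with a metric $g$ and an affine connection $\nabla$. The signature of $g$ is denoted by $s$; it enters only through the sign $(-1)^s$. Indices are raised and lowered with $g$, and repeated indices are summed. $\varepsilon_{\alpha\beta\kappa\lambda}$ is the (totally antisymmetric) $4$-dimensional Levi-Civita pseudo-tensor, satisfying $\varepsilon_{\alpha\mu\beta\gamma}\varepsilon^{\kappa\lambda\rho\sigma}=(-1)^s\,4!\,\delta^{\kappa}_{[\alpha}\delta^{\lambda}_{\mu}\delta^{\rho}_{\beta}\delta^{\sigma}_{\gamma]}$. Square brackets denote normalized antisymmetrization, e.g. $X_{[\alpha}g_{\mu]\nu}=\frac12(X_\alpha g_{\mu\nu}-X_\mu g_{\alpha\nu})$. **Traces.** For a rank-$3$ tensor $N_{\alpha\mu\nu}$: $N^{(1)}_\mu=N_{\alpha\beta\mu}g^{\alpha\beta}$, $N^{(2)}_\mu=N_{\alpha\mu\beta}g^{\alpha\beta}$,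 $N^{(3)}_\mu=N_{\mu\alpha\beta}g^{\alpha\beta}$, and $M^\alpha=N^{(4)\alpha}=\varepsilon^{\alpha\mu\nu\lambda}N_{\mu\nu\lambda}$. The $B^{(j)}_\mu$, $j=1,\dots,4$, are defined in the same way from $B_{\alpha\mu\nu}$. **Parity-odd contractions.** $M^{(1)}_{\lambda\alpha\beta}=N_{\mu\nu\lambda}\varepsilon^{\mu\nu}{}_{\alpha\beta}$, $M^{(2)}_{\nu\alpha\beta}=N_{\mu\nu\lambda}\varepsilon^{\mu\lambda}{}_{\alpha\beta}$, $M^{(3)}_{\mu\alpha\beta}=N_{\mu\nu\lambda}\varepsilon^{\nu\lambda}{}_{\alpha\beta}$. Each is antisymmetric in its last pair of indices. **The matrix $\Gamma=(\gamma_{ij})$.** - $\gamma_{11}=a_1+a_3+a_{71}+4a_{81}+a_{91}$, $\gamma_{12}=a_2+a_4+a_{72}+4a_{82}+a_{92}$, $\gamma_{13}=a_5+a_6+a_{73}+4a_{83}+a_{93}$, $\gamma_{14}=c_1+4c_2+c_3-b_{12}-b_{13}-b_{21}-b_{23}-b_{31}-b_{33}$. - $\gamma_{21}=a_2+a_5+4a_{71}+a_{81}+a_{91}$, $\gamma_{22}=a_1+a_6+4a_{72}+a_{82}+a_{92}$, $\gamma_{23}=a_3+a_4+4a_{73}+a_{83}+a_{93}$, $\gamma_{24}=4c_1+c_2+c_3+b_{11}+b_{22}-b_{12}-b_{21}-b_{31}-b_{32}$. - $\gamma_{31}=a_5+a_6+a_{71}+a_{81}+4a_{91}$, $\gamma_{32}=a_3+a_4+a_{72}+a_{82}+4a_{92}$,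 $\gamma_{33}=a_1+a_2+a_{73}+a_{83}+4a_{93}$, $\gamma_{34}=c_1+c_2+4c_3+b_{12}-b_{13}-b_{22}+b_{23}+b_{32}-b_{33}$. - $\gamma_{41}=-2(-1)^s(b_{21}+b_{22}+b_{23}+b_{31}+b_{32}+b_{33}-3b_1)$, $\gamma_{42}=-2(-1)^s(b_{11}+b_{12}+b_{13}-b_{31}-b_{32}-b_{33}-3b_2)$, $\gamma_{43}=2(-1)^s(b_{11}+b_{12}+b_{13}+b_{21}+b_{22}+b_{23}+3b_3)$, $\gamma_{44}=a_1+a_2+a_3-a_4-a_5-a_6$. **The matrix $A$.** Its columns are ordered according to $$\mathcal N=\big(N_{\alpha\mu\nu},N_{\nu\alpha\mu},N_{\mu\nu\alpha},N_{\alpha\nu\mu},N_{\nu\mu\alpha},N_{\mu\alpha\nu},M^{(1)}_{\alpha\mu\nu},M^{(1)}_{\nu\alpha\mu},M^{(1)}_{\mu\nu\alpha},M^{(2)}_{\alpha\mu\nu},M^{(2)}_{\nu\alpha\mu},M^{(2)}_{\mu\nu\alpha},M^{(3)}_{\alpha\mu\nu},M^{(3)}_{\nu\alpha\mu},M^{(3)}_{\mu\nu\alpha}\big)^T.$$ Put $\sigma=(-1)^s$ and, for $i=1,2,3$, $u_i=2b_{i2}-b_{i1}-b_{i3}$, $v_i=b_{i1}+b_{i2}-2b_{i3}$, $w_i=2b_{i1}-b_{i2}-b_{i3}$, $(p_1,p_2,p_3)=(a_1-a_6,\,a_4-a_3,\,a_2-a_5)$, $(q_1,q_2,q_3)=(a_4-a_2,\,a_1-a_5,\,a_6-a_3)$,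 $(r_1,r_2,r_3)=(a_3-a_5,\,a_6-a_2,\,a_1-a_4)$. Each row below lists the first six entries, followed by the triple occupying columns $(4+3i,\,5+3i,\,6+3i)$ for each $i=1,2,3$: - Row 1: $(a_1,a_2,a_3,a_4,a_5,a_6)$; $(b_{i1},b_{i2},b_{i3})$ - Row 2: $(a_3,a_1,a_2,a_5,a_6,a_4)$; $(b_{i3},b_{i1},b_{i2})$ - Row 3: $(a_2,a_3,a_1,a_6,a_4,a_5)$; $(b_{i2},b_{i3},b_{i1})$ - Row 4: $(a_4,a_6,a_5,a_1,a_3,a_2)$; $(-b_{i1},-b_{i3},-b_{i2})$ - Row 5: $(a_5,a_4,a_6,a_2,a_1,a_3)$; $(-b_{i2},-b_{i1},-b_{i3})$ - Row 6: $(a_6,a_5,a_4,a_3,a_2,a_1)$; $(-b_{i3},-b_{i2},-b_{i1})$ - Row 7: $\sigma(u_1,u_3,-u_2,u_2,-u_3,-u_1)$; $(0,p_i,0)$ - Row 8: $\sigma(u_3,-u_2,u_1,-u_3,-u_1,u_2)$; $(p_i,0,0)$ - Row 9: $\sigma(-u_2,u_1,u_3,-u_1,u_2,-u_3)$; $(0,0,p_i)$ - Row 10: $\sigma(v_2,-v_1,-v_3,v_1,-v_2,v_3)$; $(0,0,-q_i)$ - Row 11: $\sigma(-v_1,-v_3,v_2,-v_2,v_3,v_1)$; $(0,-q_i,0)$ - Row 12: $\sigma(-v_3,v_2,-v_1,v_3,v_1,-v_2)$; $(-q_i,0,0)$ - Row 13: $\sigma(w_3,-w_2,w_1,-w_3,-w_1,w_2)$;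 $(r_i,0,0)$ - Row 14: $\sigma(-w_2,w_1,w_3,-w_1,w_2,-w_3)$; $(0,0,r_i)$ - Row 15: $\sigma(w_1,w_3,-w_2,w_2,-w_3,-w_1)$; $(0,r_i,0)$
   Formalization: Corrected: a1..a6 in rows 1–3, columns 1–3 of Γ; b-signs in γ14 and of b31 in γ24; columns 4–6 of rows 2 and 3 of A interchanged; +2(−1)^s instead of −2(−1)^s in B̆. As printed the formula fails, e.g. for a3=1, a6=2, all else 0. *)

theory Defs
  imports "HOL-Analysis.Analysis"
begin

text \<open>
  Everything is stated for components at one point with respect to one arbitrary frame.  A rank-3
  object is its array of components, with no transformation law imposed, so that tensors, tensor
  densities and connections are all covered.  Indices range over the type \<^typ>\<open>4\<close>, whose
  elements are 1, 2, 3 and 4 (= 0).  The families of parameters are functions on \<^typ>\<open>nat\<close>,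
  used only at the arguments 1, 2, ....
\<close>

type_synonym tensor1 = "4 \<Rightarrow> real"
type_synonym tensor3 = "4 \<Rightarrow> 4 \<Rightarrow> 4 \<Rightarrow> real"
type_synonym tensor4 = "4 \<Rightarrow> 4 \<Rightarrow> 4 \<Rightarrow> 4 \<Rightarrow> real"


subsection \<open>Metric and Levi-Civita pseudo-tensor\<close>

text \<open>The signature is the number of minus signs in a diagonal form of the metric; it is this
  number whose parity is the sign of the determinant.\<close>

definition metric_of_signature :: "real^4^4 \<Rightarrow> nat \<Rightarrow> bool" where
  "metric_of_signature g s \<longleftrightarrow>
     transpose g = g \<and>
     (\<exists>(P :: real^4^4) (d :: 4 \<Rightarrow> real).
        invertible P \<and> (\<forall>i. d i = 1 \<or> d i = -1) \<and> card {i. d i = -1} = s \<and>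
        transpose P ** g ** P = (\<chi> i j. if i = j then d i else 0))"

definition ginv :: "real^4^4 \<Rightarrow> 4 \<Rightarrow> 4 \<Rightarrow> real" where
  "ginv g \<alpha> \<beta> = matrix_inv g $ \<alpha> $ \<beta>"

definition raise1 :: "real^4^4 \<Rightarrow> tensor1 \<Rightarrow> tensor1" where
  "raise1 g X \<rho> = (\<Sum>\<tau>\<in>UNIV. ginv g \<rho> \<tau> * X \<tau>)"

definition lower1 :: "real^4^4 \<Rightarrow> tensor1 \<Rightarrow> tensor1" where
  "lower1 g X \<mu> = (\<Sum>\<tau>\<in>UNIV. g $ \<mu> $ \<tau> * X \<tau>)"

text \<open>The pseudo-tensor with its first index, its first two indices, all its indices raised.\<close>

definition eps_up1 :: "real^4^4 \<Rightarrow> tensor4 \<Rightarrow> tensor4" where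
  "eps_up1 g eps \<rho> \<alpha> \<mu> \<nu> = (\<Sum>\<tau>\<in>UNIV. ginv g \<rho> \<tau> * eps \<tau> \<alpha> \<mu> \<nu>)"

definition eps_up2 :: "real^4^4 \<Rightarrow> tensor4 \<Rightarrow> tensor4" where
  "eps_up2 g eps \<mu> \<nu> \<alpha> \<beta> =
     (\<Sum>\<kappa>\<in>UNIV. \<Sum>\<tau>\<in>UNIV. ginv g \<mu> \<kappa> * ginv g \<nu> \<tau> * eps \<kappa> \<tau> \<alpha> \<beta>)"

definition eps_up4 :: "real^4^4 \<Rightarrow> tensor4 \<Rightarrow> tensor4" where
  "eps_up4 g eps \<kappa> \<tau> \<rho> \<sigma> =
     (\<Sum>\<alpha>\<in>UNIV. \<Sum>\<beta>\<in>UNIV. \<Sum>\<gamma>\<in>UNIV. \<Sum>\<delta>\<in>UNIV.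
        ginv g \<kappa> \<alpha> * ginv g \<tau> \<beta> * ginv g \<rho> \<gamma> * ginv g \<sigma> \<delta> * eps \<alpha> \<beta> \<gamma> \<delta>)"

text \<open>The normalized antisymmetrization over the lower indices \<open>l 1, ..., l 4\<close> of the product of
  the Kronecker deltas with upper indices \<open>u 1, ..., u 4\<close>.\<close>

definition antisym_delta :: "(4 \<Rightarrow> 4) \<Rightarrow> (4 \<Rightarrow> 4) \<Rightarrow> real" where
  "antisym_delta u l =
     (1 / fact 4) * (\<Sum>p | p permutes (UNIV :: 4 set).
        of_int (sign p) * (\<Prod>i\<in>UNIV. if u i = l (p i) then 1 else 0))"

text \<open>The conditions determine the pseudo-tensor up to sign, so both orientations are allowed.\<close>

definition levi_civita :: "real^4^4 \<Rightarrow> nat \<Rightarrow> tensor4 \<Rightarrow> bool" where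
  "levi_civita g s eps \<longleftrightarrow>
     (\<forall>\<alpha> \<beta> \<kappa> \<tau>. eps \<beta> \<alpha> \<kappa> \<tau> = - eps \<alpha> \<beta> \<kappa> \<tau> \<and>
                eps \<alpha> \<kappa> \<beta> \<tau> = - eps \<alpha> \<beta> \<kappa> \<tau> \<and>
                eps \<alpha> \<beta> \<tau> \<kappa> = - eps \<alpha> \<beta> \<kappa> \<tau>) \<and>
     (\<forall>l u. eps (l 1) (l 2) (l 3) (l 4) * eps_up4 g eps (u 1) (u 2) (u 3) (u 4) =
            (-1) ^ s * fact 4 * antisym_delta u l)"


subsection \<open>Traces and parity-odd contractions\<close>

text \<open>The fourth trace is naturally a vector; it is used with its index lowered.\<close>

definition tr :: "real^4^4 \<Rightarrow> tensor4 \<Rightarrow> nat \<Rightarrow> tensor3 \<Rightarrow> tensor1" where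
  "tr g eps i N \<mu> =
     (if i = 1 then (\<Sum>\<alpha>\<in>UNIV. \<Sum>\<beta>\<in>UNIV. N \<alpha> \<beta> \<mu> * ginv g \<alpha> \<beta>)
      else if i = 2 then (\<Sum>\<alpha>\<in>UNIV. \<Sum>\<beta>\<in>UNIV. N \<alpha> \<mu> \<beta> * ginv g \<alpha> \<beta>)
      else if i = 3 then (\<Sum>\<alpha>\<in>UNIV. \<Sum>\<beta>\<in>UNIV. N \<mu> \<alpha> \<beta> * ginv g \<alpha> \<beta>)
      else lower1 g (\<lambda>\<alpha>. \<Sum>\<kappa>\<in>UNIV. \<Sum>\<nu>\<in>UNIV. \<Sum>\<tau>\<in>UNIV. eps_up4 g eps \<alpha> \<kappa> \<nu> \<tau> * N \<kappa> \<nu> \<tau>) \<mu>)"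

definition oddc :: "real^4^4 \<Rightarrow> tensor4 \<Rightarrow> nat \<Rightarrow> tensor3 \<Rightarrow> tensor3" where
  "oddc g eps i N \<kappa> \<alpha> \<beta> =
     (if i = 1 then (\<Sum>\<mu>\<in>UNIV. \<Sum>\<nu>\<in>UNIV. N \<mu> \<nu> \<kappa> * eps_up2 g eps \<mu> \<nu> \<alpha> \<beta>)
      else if i = 2 then (\<Sum>\<mu>\<in>UNIV. \<Sum>\<tau>\<in>UNIV. N \<mu> \<kappa> \<tau> * eps_up2 g eps \<mu> \<tau> \<alpha> \<beta>)
      else (\<Sum>\<nu>\<in>UNIV. \<Sum>\<tau>\<in>UNIV. N \<kappa> \<nu> \<tau> * eps_up2 g eps \<nu> \<tau> \<alpha> \<beta>))"


subsection \<open>The two matrices\<close>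

text \<open>
  \<open>Gmat\<close> is the matrix of the linear system for the four traces that one gets by contracting the
  tensor equation with the metric in its three index pairs and with the Levi-Civita pseudo-tensor:
  the sum over \<open>j\<close> of \<open>Gmat $ i $ j\<close> times the \<open>j\<close>-th trace of \<open>N\<close> is the \<open>i\<close>-th trace of \<open>B\<close>.
  In rows 1 to 3 the source misprints the contributions of \<open>a 1, ..., a 6\<close> to columns 1 to 3,
  and the contributions of \<open>b\<close> to column 4 (several in row 1, the sign of \<open>b 3 1\<close> in row 2);
  with the printed entries the system, and with it the theorem, is false.
\<close>

definition Gmat ::
  "nat \<Rightarrow> (nat \<Rightarrow> real) \<Rightarrow> (nat \<Rightarrow> real) \<Rightarrow> (nat \<Rightarrow> real) \<Rightarrow> (nat \<Rightarrow> real) \<Rightarrow>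
   (nat \<Rightarrow> nat \<Rightarrow> real) \<Rightarrow> (nat \<Rightarrow> real) \<Rightarrow> (nat \<Rightarrow> real) \<Rightarrow> real^4^4" where
  "Gmat s a a7 a8 a9 b bs c = vector [
     vector [a 1 + a 6 + a7 1 + 4 * a8 1 + a9 1,
             a 3 + a 4 + a7 2 + 4 * a8 2 + a9 2,
             a 2 + a 5 + a7 3 + 4 * a8 3 + a9 3,
             c 1 + 4 * c 2 + c 3 - b 1 1 + b 1 3 + b 2 1 - b 2 3 - b 3 1 + b 3 3],
     vector [a 2 + a 4 + 4 * a7 1 + a8 1 + a9 1,
             a 1 + a 5 + 4 * a7 2 + a8 2 + a9 2,
             a 3 + a 6 + 4 * a7 3 + a8 3 + a9 3,
             4 * c 1 + c 2 + c 3 + b 1 1 + b 2 2 - b 1 2 - b 2 1 + b 3 1 - b 3 2],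
     vector [a 3 + a 5 + a7 1 + a8 1 + 4 * a9 1,
             a 2 + a 6 + a7 2 + a8 2 + 4 * a9 2,
             a 1 + a 4 + a7 3 + a8 3 + 4 * a9 3,
             c 1 + c 2 + 4 * c 3 + b 1 2 - b 1 3 - b 2 2 + b 2 3 + b 3 2 - b 3 3],
     vector [-2 * (-1) ^ s * (b 2 1 + b 2 2 + b 2 3 + b 3 1 + b 3 2 + b 3 3 - 3 * bs 1),
             -2 * (-1) ^ s * (b 1 1 + b 1 2 + b 1 3 - b 3 1 - b 3 2 - b 3 3 - 3 * bs 2),
             2 * (-1) ^ s * (b 1 1 + b 1 2 + b 1 3 + b 2 1 + b 2 2 + b 2 3 + 3 * bs 3),
             a 1 + a 2 + a 3 - a 4 - a 5 - a 6]]"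

definition row15 :: "real list \<Rightarrow> (nat \<Rightarrow> real list) \<Rightarrow> real^15" where
  "row15 xs t = vector (xs @ t 1 @ t 2 @ t 3)"

text \<open>
  The columns of \<open>Amat\<close> belong to the six index permutations
  \<open>\<alpha>\<mu>\<nu>, \<nu>\<alpha>\<mu>, \<mu>\<nu>\<alpha>, \<alpha>\<nu>\<mu>, \<nu>\<mu>\<alpha>, \<mu>\<alpha>\<nu>\<close> of the unknown, followed by the permutations \<open>\<alpha>\<mu>\<nu>, \<nu>\<alpha>\<mu>, \<mu>\<nu>\<alpha>\<close>
  of its three parity-odd contractions.  Rows 2 and 3 are the first row for the indices
  \<open>\<nu>\<alpha>\<mu>\<close> and \<open>\<mu>\<nu>\<alpha>\<close>; the source interchanges the entries in
  columns 4 to 6 between these two rows, which makes the theorem false.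
\<close>

definition Amat :: "nat \<Rightarrow> (nat \<Rightarrow> real) \<Rightarrow> (nat \<Rightarrow> nat \<Rightarrow> real) \<Rightarrow> real^15^15" where
  "Amat s a b =
    (let sg = map (\<lambda>x. (-1) ^ s * x);
         u = (\<lambda>i. 2 * b i 2 - b i 1 - b i 3);
         v = (\<lambda>i. b i 1 + b i 2 - 2 * b i 3);
         w = (\<lambda>i. 2 * b i 1 - b i 2 - b i 3);
         p = (\<lambda>i. [a 1 - a 6, a 4 - a 3, a 2 - a 5] ! (i - 1));
         q = (\<lambda>i. [a 4 - a 2, a 1 - a 5, a 6 - a 3] ! (i - 1));
         r = (\<lambda>i. [a 3 - a 5, a 6 - a 2, a 1 - a 4] ! (i - 1))
     in vector [
       row15 [a 1, a 2, a 3, a 4, a 5, a 6] (\<lambda>i. [b i 1, b i 2, b i 3]),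
       row15 [a 3, a 1, a 2, a 6, a 4, a 5] (\<lambda>i. [b i 3, b i 1, b i 2]),
       row15 [a 2, a 3, a 1, a 5, a 6, a 4] (\<lambda>i. [b i 2, b i 3, b i 1]),
       row15 [a 4, a 6, a 5, a 1, a 3, a 2] (\<lambda>i. [- b i 1, - b i 3, - b i 2]),
       row15 [a 5, a 4, a 6, a 2, a 1, a 3] (\<lambda>i. [- b i 2, - b i 1, - b i 3]),
       row15 [a 6, a 5, a 4, a 3, a 2, a 1] (\<lambda>i. [- b i 3, - b i 2, - b i 1]),
       row15 (sg [u 1, u 3, - u 2, u 2, - u 3, - u 1]) (\<lambda>i. [0, p i, 0]),
       row15 (sg [u 3, - u 2, u 1, - u 3, - u 1, u 2]) (\<lambda>i. [p i, 0, 0]),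
       row15 (sg [- u 2, u 1, u 3, - u 1, u 2, - u 3]) (\<lambda>i. [0, 0, p i]),
       row15 (sg [v 2, - v 1, - v 3, v 1, - v 2, v 3]) (\<lambda>i. [0, 0, - q i]),
       row15 (sg [- v 1, - v 3, v 2, - v 2, v 3, v 1]) (\<lambda>i. [0, - q i, 0]),
       row15 (sg [- v 3, v 2, - v 1, v 3, v 1, - v 2]) (\<lambda>i. [- q i, 0, 0]),
       row15 (sg [w 3, - w 2, w 1, - w 3, - w 1, w 2]) (\<lambda>i. [r i, 0, 0]),
       row15 (sg [- w 2, w 1, w 3, - w 1, w 2, - w 3]) (\<lambda>i. [0, 0, r i]),
       row15 (sg [w 1, w 3, - w 2, w 2, - w 3, - w 1]) (\<lambda>i. [0, r i, 0])])"


subsection \<open>The tensors occurring in the solution\<close>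

text \<open>In what follows \<open>gi\<close> stands for the inverse of \<open>Gmat\<close>.\<close>

definition B_hat ::
  "real^4^4 \<Rightarrow> tensor4 \<Rightarrow> real^4^4 \<Rightarrow> (nat \<Rightarrow> real) \<Rightarrow> (nat \<Rightarrow> real) \<Rightarrow> (nat \<Rightarrow> real) \<Rightarrow>
   (nat \<Rightarrow> real) \<Rightarrow> (nat \<Rightarrow> real) \<Rightarrow> tensor3 \<Rightarrow> tensor3" where
  "B_hat g eps gi a7 a8 a9 bs c B \<alpha> \<mu> \<nu> =
    (let \<gamma> = (\<lambda>i j. gi $ of_nat i $ of_nat j);
         a7' = a7(4 := c 1); a8' = a8(4 := c 2); a9' = a9(4 := c 3)
     in B \<alpha> \<mu> \<nu>
        - (\<Sum>i=1..4. \<Sum>j=1..4.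
             a7' i * \<gamma> i j * tr g eps j B \<mu> * g $ \<alpha> $ \<nu>
           + a8' i * \<gamma> i j * tr g eps j B \<nu> * g $ \<alpha> $ \<mu>
           + a9' i * \<gamma> i j * tr g eps j B \<alpha> * g $ \<mu> $ \<nu>)
        - (\<Sum>\<rho>\<in>UNIV. eps_up1 g eps \<rho> \<alpha> \<mu> \<nu> *
             (\<Sum>i=1..3. \<Sum>j=1..4. bs i * \<gamma> i j * tr g eps j B \<rho>)))"

text \<open>\<open>X\<^bsub>[\<alpha>\<^esub> g\<^bsub>\<mu>]\<nu>\<^esub>\<close>\<close>

definition antisym_g :: "real^4^4 \<Rightarrow> tensor1 \<Rightarrow> 4 \<Rightarrow> 4 \<Rightarrow> 4 \<Rightarrow> real" where
  "antisym_g g X \<alpha> \<mu> \<nu> = (1 / 2) * (X \<alpha> * g $ \<mu> $ \<nu> - X \<mu> * g $ \<alpha> $ \<nu>)"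

text \<open>The sign of the trace term of \<open>B_breve\<close> is the opposite of the one printed in the source;
  it is forced by contracting the tensor equation, exactly as the signs in \<open>B_bar\<close> and \<open>B_ring\<close>.\<close>

definition B_breve ::
  "nat \<Rightarrow> real^4^4 \<Rightarrow> tensor4 \<Rightarrow> real^4^4 \<Rightarrow> (nat \<Rightarrow> nat \<Rightarrow> real) \<Rightarrow> tensor3 \<Rightarrow> tensor3 \<Rightarrow> tensor3" where
  "B_breve s g eps gi b Bh B \<alpha> \<mu> \<nu> =
    (let \<gamma> = (\<lambda>i j. gi $ of_nat i $ of_nat j)
     in (\<Sum>\<beta>\<in>UNIV. \<Sum>\<kappa>\<in>UNIV. eps_up2 g eps \<beta> \<kappa> \<alpha> \<mu> * Bh \<beta> \<kappa> \<nu>)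
        + 2 * (-1) ^ s * (\<Sum>j=1..4.
            ((b 2 1 + b 2 3 + b 3 1 + b 3 3) * \<gamma> 1 j + (b 1 1 + b 1 3 - b 3 1 - b 3 3) * \<gamma> 2 j
             - (b 1 1 + b 1 3 + b 2 1 + b 2 3) * \<gamma> 3 j) * antisym_g g (tr g eps j B) \<alpha> \<mu> \<nu>))"

definition B_bar ::
  "nat \<Rightarrow> real^4^4 \<Rightarrow> tensor4 \<Rightarrow> real^4^4 \<Rightarrow> (nat \<Rightarrow> nat \<Rightarrow> real) \<Rightarrow> tensor3 \<Rightarrow> tensor3 \<Rightarrow> tensor3" where
  "B_bar s g eps gi b Bh B \<alpha> \<mu> \<nu> =
    (let \<gamma> = (\<lambda>i j. gi $ of_nat i $ of_nat j)
     in (\<Sum>\<beta>\<in>UNIV. \<Sum>\<kappa>\<in>UNIV. eps_up2 g eps \<beta> \<kappa> \<alpha> \<nu> * Bh \<beta> \<mu> \<kappa>)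
        - 2 * (-1) ^ s * (\<Sum>j=1..4.
            ((b 2 1 + b 2 2 + b 3 1 + b 3 2) * \<gamma> 1 j + (b 1 1 + b 1 2 - b 3 1 - b 3 2) * \<gamma> 2 j
             - (b 1 1 + b 1 2 + b 2 1 + b 2 2) * \<gamma> 3 j) * antisym_g g (tr g eps j B) \<alpha> \<nu> \<mu>))"

definition B_ring ::
  "nat \<Rightarrow> real^4^4 \<Rightarrow> tensor4 \<Rightarrow> real^4^4 \<Rightarrow> (nat \<Rightarrow> nat \<Rightarrow> real) \<Rightarrow> tensor3 \<Rightarrow> tensor3 \<Rightarrow> tensor3" where
  "B_ring s g eps gi b Bh B \<alpha> \<mu> \<nu> =
    (let \<gamma> = (\<lambda>i j. gi $ of_nat i $ of_nat j)
     in (\<Sum>\<beta>\<in>UNIV. \<Sum>\<kappa>\<in>UNIV. eps_up2 g eps \<beta> \<kappa> \<mu> \<nu> * Bh \<alpha> \<beta> \<kappa>)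
        - 2 * (-1) ^ (s + 1) * (\<Sum>j=1..4.
            ((b 2 2 + b 2 3 + b 3 2 + b 3 3) * \<gamma> 1 j + (b 1 2 + b 1 3 - b 3 2 - b 3 3) * \<gamma> 2 j
             - (b 2 2 + b 2 3 + b 1 2 + b 1 3) * \<gamma> 3 j) * antisym_g g (tr g eps j B) \<mu> \<nu> \<alpha>))"

end

theory Submission
  imports Defs
begin

text \<open>
  Contracting the equation with the metric in its three index pairs and with the pseudo-tensor gives
  a linear system with matrix \<open>Gmat\<close> for the four traces of the unknown, so the traces are known and
  the part of the equation without trace terms equals \<open>B_hat\<close>.  Its index permutations,
  and its three contractions with the pseudo-tensor, in which products of two pseudo-tensors reduce
  to Kronecker deltas, form a linear system with matrix \<open>Amat\<close> for the index permutations of the unknown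
  and of its parity-odd contractions; its first component is the stated formula.  This shows
  uniqueness for every right-hand side; as the space of rank-3 arrays has finite dimension,
  existence follows.
\<close>

text \<open>Fifteen unknowns suffice because each parity-odd contraction is antisymmetric in its
  last index pair, which leaves three of the six permutations: 6 + 3 * 3. The system closes on them
  only after a correction. Two pseudo-tensors sharing a single summed pair leave, besides pure
  Kronecker deltas, products of the metric with its inverse, hence a metric times a trace of the
  unknown; the trace terms in \<open>B_breve\<close>, \<open>B_bar\<close> and \<open>B_ring\<close>
  cancel exactly these. The formula is never substituted into the equation. Inverting
  \<open>Amat\<close> yields fifteen numbers for each index triple, but that they are the
  permutations and contractions of one single array is not evident; uniqueness avoids this question,
  since it starts from an array that solves the equation. All pseudo-tensor identities come from
  antisymmetry and the defining product relation. No component of \<open>eps\<close> is computed, so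
  the frame stays arbitrary.\<close>

section \<open>Determinants of order four and vectors of length fifteen\<close>

text \<open>Repeated expansion along rows. It makes the antisymmetrized product of Kronecker deltas,
  a 4 by 4 determinant, an explicit polynomial.\<close>

lemma det_4:
  "det (A::'a::comm_ring_1^4^4) =
    A$1$1 * (A$2$2 * (A$3$3 * A$4$4 - A$3$4 * A$4$3)
           - A$2$3 * (A$3$2 * A$4$4 - A$3$4 * A$4$2)
           + A$2$4 * (A$3$2 * A$4$3 - A$3$3 * A$4$2))
  - A$1$2 * (A$2$1 * (A$3$3 * A$4$4 - A$3$4 * A$4$3)
           - A$2$3 * (A$3$1 * A$4$4 - A$3$4 * A$4$1)
           + A$2$4 * (A$3$1 * A$4$3 - A$3$3 * A$4$1))
  + A$1$3 * (A$2$1 * (A$3$2 * A$4$4 - A$3$4 * A$4$2)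
           - A$2$2 * (A$3$1 * A$4$4 - A$3$4 * A$4$1)
           + A$2$4 * (A$3$1 * A$4$2 - A$3$2 * A$4$1))
  - A$1$4 * (A$2$1 * (A$3$2 * A$4$3 - A$3$3 * A$4$2)
           - A$2$2 * (A$3$1 * A$4$3 - A$3$3 * A$4$1)
           + A$2$3 * (A$3$1 * A$4$2 - A$3$2 * A$4$1))"
proof -
  have f1234: "finite {2::4, 3, 4}" "1 \<notin> {2::4, 3, 4}"
    by auto
  have f234: "finite {3::4, 4}" "2 \<notin> {3::4, 4}"
    by auto
  have f34: "finite {4::4}" "3 \<notin> {4::4}"
    by auto
  show ?thesis
    unfolding det_def UNIV_4
    unfolding sum_over_permutations_insert[OF f1234]
    unfolding sum_over_permutations_insert[OF f234]
    unfolding sum_over_permutations_insert[OF f34]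
    unfolding permutes_sing
    by (simp add: sign_swap_id permutation_swap_id permutation_compose sign_compose sign_id swap_id_eq algebra_simps)
qed

lemma exhaust_15:
  fixes x :: 15
  shows "x \<in> {1, 2, 3, 4, 5, 6, 7, 8, 9, 10, 11, 12, 13, 14, 15}"
proof (induct x)
  case (of_int z)
  \<comment> \<open>The representatives run from 0 to 14, the listed indices from 1 to 15: the
    numeral 15 denotes the residue 0.\<close>
  then have "z \<in> {0, 1, 2, 3, 4, 5, 6, 7, 8, 9, 10, 11, 12, 13, 14}"
    by simp presburger
  then show ?case by auto
qed

lemma UNIV_15: "UNIV = {1, 2, 3, 4, 5, 6, 7, 8, 9, 10, 11, 12, 13, 14, 15::15}"
  using exhaust_15 by blast

lemma sum_15: "sum f (UNIV::15 set) = f 1 + f 2 + f 3 + f 4 + f 5 + f 6 + f 7 + f 8 + f 9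
    + f 10 + f 11 + f 12 + f 13 + f 14 + f 15"
  unfolding UNIV_15 by (simp add: ac_simps)

lemma vector_15:
  fixes x1 x2 x3 x4 x5 x6 x7 x8 x9 x10 x11 x12 x13 x14 x15 :: "'a::zero"
  defines "v \<equiv> vector [x1, x2, x3, x4, x5, x6, x7, x8, x9, x10, x11, x12, x13, x14, x15] :: 'a^15"
  shows "v $ 1 = x1" "v $ 2 = x2" "v $ 3 = x3" "v $ 4 = x4" "v $ 5 = x5" "v $ 6 = x6" "v $ 7 = x7"
    "v $ 8 = x8" "v $ 9 = x9" "v $ 10 = x10" "v $ 11 = x11" "v $ 12 = x12" "v $ 13 = x13"
    "v $ 14 = x14" "v $ 15 = x15"
  unfolding v_def vector_def by simp_all

text \<open>Turns any row of \<open>Amat\<close>, whatever its entries, into an explicit linear form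
  in one rewrite.\<close>

lemma row15_mult_vector:
  "(\<Sum>j\<in>UNIV. row15 [x1, x2, x3, x4, x5, x6] (\<lambda>i. [t1 i, t2 i, t3 i]) $ j
      * (vector [y1, y2, y3, y4, y5, y6, y7, y8, y9, y10, y11, y12, y13, y14, y15] :: real^15) $ j)
    = x1 * y1 + x2 * y2 + x3 * y3 + x4 * y4 + x5 * y5 + x6 * y6
    + t1 1 * y7 + t2 1 * y8 + t3 1 * y9
    + t1 2 * y10 + t2 2 * y11 + t3 2 * y12 + t1 3 * y13 + t2 3 * y14 + t3 3 * y15"
  by (simp add: sum_15 row15_def vector_def)

lemma matrix_inv_left_right:
  fixes A :: "real^'n^'m"
  assumes "invertible A"
  shows "A ** matrix_inv A = mat 1 \<and> matrix_inv A ** A = mat 1"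
  using assms unfolding matrix_inv_def invertible_def by (rule someI_ex)

section \<open>Kronecker deltas\<close>

text \<open>Kept opaque: sums are contracted by \<open>sum_kd\<close>, with no case split on the
  equality of indices.\<close>

definition kd :: "4 \<Rightarrow> 4 \<Rightarrow> real" where
  "kd i j = (if i = j then 1 else 0)"

lemma kd_commute: "kd i j = kd j i"
  by (simp add: kd_def)

lemma sum_kd [simp]:
  "(\<Sum>j\<in>UNIV. kd i j * f j) = f i" "(\<Sum>j\<in>UNIV. kd j i * f j) = f i"
  "(\<Sum>j\<in>UNIV. f j * kd i j) = f i" "(\<Sum>j\<in>UNIV. f j * kd j i) = f i"
  by (simp_all add: kd_def if_distrib if_distribR cong: if_cong)

lemma antisym_delta_eq_det: "antisym_delta u l = det (\<chi> i j. kd (u i) (l j)) / fact 4"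
  by (simp add: antisym_delta_def det_def kd_def)

text \<open>\<open>levi_civita\<close> quantifies over index functions, so four given indices have
  to be packed into one function.\<close>

definition quad :: "4 \<Rightarrow> 4 \<Rightarrow> 4 \<Rightarrow> 4 \<Rightarrow> 4 \<Rightarrow> 4" where
  "quad \<alpha> \<beta> \<gamma> \<delta> i = (if i = 1 then \<alpha> else if i = 2 then \<beta> else if i = 3 then \<gamma> else \<delta>)"

lemma quad_simps: "quad \<alpha> \<beta> \<gamma> \<delta> 1 = \<alpha>" "quad \<alpha> \<beta> \<gamma> \<delta> 2 = \<beta>"
    "quad \<alpha> \<beta> \<gamma> \<delta> 3 = \<gamma>" "quad \<alpha> \<beta> \<gamma> \<delta> 4 = \<delta>"
  by (simp_all add: quad_def)

text \<open>The generalized Kronecker delta of order three, that is, a 3 by 3 determinant of deltas,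
  without the factor 1/3!.\<close>

definition kd3 :: "4 \<Rightarrow> 4 \<Rightarrow> 4 \<Rightarrow> 4 \<Rightarrow> 4 \<Rightarrow> 4 \<Rightarrow> real" where
  "kd3 \<alpha> \<beta> \<gamma> \<kappa> \<tau> \<rho> =
    kd \<alpha> \<kappa> * (kd \<beta> \<tau> * kd \<gamma> \<rho> - kd \<beta> \<rho> * kd \<gamma> \<tau>)
  - kd \<alpha> \<tau> * (kd \<beta> \<kappa> * kd \<gamma> \<rho> - kd \<beta> \<rho> * kd \<gamma> \<kappa>)
  + kd \<alpha> \<rho> * (kd \<beta> \<kappa> * kd \<gamma> \<tau> - kd \<beta> \<tau> * kd \<gamma> \<kappa>)"

lemma trace_antisym_sym_zero:
  fixes f h :: "4 \<Rightarrow> 4 \<Rightarrow> real"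
  assumes "\<And>x y. f y x = - f x y" "\<And>x y. h y x = h x y"
  shows "(\<Sum>x\<in>UNIV. \<Sum>y\<in>UNIV. f x y * h x y) = 0"
proof -
  have "(\<Sum>x\<in>UNIV. \<Sum>y\<in>UNIV. f x y * h x y) = (\<Sum>y\<in>UNIV. \<Sum>x\<in>UNIV. f x y * h x y)"
    by (rule sum.swap)
  also have "\<dots> = (\<Sum>y\<in>UNIV. \<Sum>x\<in>UNIV. - (f y x * h y x))"
    using assms by (intro sum.cong refl) (metis mult_minus_left)
  finally show ?thesis by (simp add: sum_negf)
qed

text \<open>With this and its companion for the third contraction, the identities for products of
  pseudo-tensors are needed for the first contraction only.\<close>

lemma oddc_2_eq: "oddc g eps 2 N = oddc g eps 1 (\<lambda>x y z. N x z y)"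
  by (intro ext) (simp add: oddc_def)

lemma oddc_3_eq: "oddc g eps 3 N = oddc g eps 1 (\<lambda>x y z. N z x y)"
  by (intro ext) (simp add: oddc_def)

lemma oddc_add:
  "oddc g eps i (\<lambda>x y z. X x y z + Y x y z) \<kappa> \<alpha> \<beta> = oddc g eps i X \<kappa> \<alpha> \<beta> + oddc g eps i Y \<kappa> \<alpha> \<beta>"
  by (simp add: oddc_def distrib_right sum.distrib)

lemma oddc_mult: "oddc g eps i (\<lambda>x y z. k * X x y z) \<kappa> \<alpha> \<beta> = k * oddc g eps i X \<kappa> \<alpha> \<beta>"
  by (simp add: oddc_def sum_distrib_left mult.assoc)

lemma tr_add: "tr g eps i (\<lambda>x y z. X x y z + Y x y z) \<mu> = tr g eps i X \<mu> + tr g eps i Y \<mu>"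
  by (simp add: tr_def lower1_def distrib_right distrib_left sum.distrib)

lemma tr_mult: "tr g eps i (\<lambda>x y z. k * X x y z) \<mu> = k * tr g eps i X \<mu>"
  by (simp add: tr_def lower1_def sum_distrib_left mult_ac)

lemma sum_1_to_3: "(\<Sum>i=1..3::nat. f i) = f 1 + f 2 + (f 3 :: 'a :: comm_monoid_add)"
  by (simp add: numeral_eq_Suc ac_simps)

lemma sum_1_to_4: "(\<Sum>i=1..4::nat. f i) = f 1 + f 2 + f 3 + (f 4 :: 'a :: comm_monoid_add)"
  by (simp add: numeral_eq_Suc ac_simps)

subsection \<open>Contractions of the Levi-Civita pseudo-tensor\<close>

locale metric_frame =
  fixes g :: "real^4^4" and s :: nat and eps :: tensor4
  assumes metric: "metric_of_signature g s"
    and levi_civita_eps: "levi_civita g s eps"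
begin

abbreviation sg :: real where "sg \<equiv> (-1) ^ s"
abbreviation gu :: "4 \<Rightarrow> 4 \<Rightarrow> real" where "gu \<equiv> ginv g"
abbreviation eps4 :: tensor4 where "eps4 \<equiv> eps_up4 g eps"
abbreviation eps2 :: tensor4 where "eps2 \<equiv> eps_up2 g eps"

lemma g_sym: "g $ x $ y = g $ y $ x"
proof -
  have "transpose g $ x $ y = g $ x $ y"
    using metric by (simp add: metric_of_signature_def)
  then show ?thesis by (simp add: transpose_def)
qed

text \<open>The diagonal form has a product of signs as its determinant, and \<open>det g\<close> is
  a factor of that determinant.\<close>

lemma invertible_g: "invertible g"
proof -
  obtain P :: "real^4^4" and d :: "4 \<Rightarrow> real" where
    P: "invertible P" "\<forall>i. d i = 1 \<or> d i = -1"
      "transpose P ** g ** P = (\<chi> i j. if i = j then d i else 0)"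
    using metric unfolding metric_of_signature_def by blast
  have "det (\<chi> i j. if i = j then d i else 0) = (\<Prod>i\<in>UNIV. d i)"
    by (subst det_diagonal) auto
  also have "\<dots> \<noteq> 0"
    using P(2) by (metis neg_equal_0_iff_equal one_neq_zero prod_zero_iff finite)
  finally have "det (transpose P ** g ** P) \<noteq> 0"
    by (simp add: P(3))
  then show ?thesis
    by (simp add: det_mul invertible_det_nz)
qed

lemma g_gu: "(\<Sum>y\<in>UNIV. g $ x $ y * gu y z) = kd x z"
proof -
  have "(g ** matrix_inv g) $ x $ z = (mat 1 :: real^4^4) $ x $ z"
    using invertible_g by (simp add: matrix_inv_left_right)
  then show ?thesis
    by (simp add: matrix_matrix_mult_def ginv_def mat_def kd_def)
qed

lemma gu_g: "(\<Sum>y\<in>UNIV. gu x y * g $ y $ z) = kd x z"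
proof -
  have "(matrix_inv g ** g) $ x $ z = (mat 1 :: real^4^4) $ x $ z"
    using invertible_g by (simp add: matrix_inv_left_right)
  then show ?thesis
    by (simp add: matrix_matrix_mult_def ginv_def mat_def kd_def)
qed

lemma gu_sym: "gu x y = gu y x"
proof -
  \<comment> \<open>The identity matrix is inserted as \<open>gu\<close> times \<open>g\<close>; the
    symmetry of \<open>g\<close> then lets \<open>g\<close> cancel against the other factor.\<close>
  have "gu x y = (\<Sum>z\<in>UNIV. (\<Sum>w\<in>UNIV. gu y w * g $ w $ z) * gu x z)"
    by (simp add: gu_g)
  also have "\<dots> = (\<Sum>w\<in>UNIV. gu y w * (\<Sum>z\<in>UNIV. gu x z * g $ z $ w))"
    by (simp add: sum_distrib_left sum_distrib_right, subst sum.swap) (simp add: g_sym mult_ac)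
  finally show ?thesis
    by (simp add: gu_g)
qed

lemma lower_raise: "(\<Sum>y\<in>UNIV. g $ x $ y * (\<Sum>z\<in>UNIV. gu y z * f z)) = f x"
proof -
  have "(\<Sum>y\<in>UNIV. g $ x $ y * (\<Sum>z\<in>UNIV. gu y z * f z))
      = (\<Sum>z\<in>UNIV. \<Sum>y\<in>UNIV. g $ x $ y * gu y z * f z)"
    by (simp add: sum_distrib_left mult.assoc) (rule sum.swap)
  then show ?thesis
    by (simp add: g_gu flip: sum_distrib_right)
qed

lemma raise_lower: "(\<Sum>y\<in>UNIV. gu x y * (\<Sum>z\<in>UNIV. g $ y $ z * f z)) = f x"
proof -
  have "(\<Sum>y\<in>UNIV. gu x y * (\<Sum>z\<in>UNIV. g $ y $ z * f z))
      = (\<Sum>z\<in>UNIV. \<Sum>y\<in>UNIV. gu x y * g $ y $ z * f z)"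
    by (simp add: sum_distrib_left mult.assoc) (rule sum.swap)
  then show ?thesis
    by (simp add: gu_g flip: sum_distrib_right)
qed

text \<open>A summed index may be lowered in one factor and raised in the other. This brings a
  product of two \<open>eps2\<close> closer to the form \<open>eps\<close> times
  \<open>eps4\<close>, the only one for which a product relation is given.\<close>

lemma contract_raise_lower:
  "(\<Sum>y\<in>UNIV. (\<Sum>x\<in>UNIV. gu y x * f x) * (\<Sum>z\<in>UNIV. g $ y $ z * h z)) = (\<Sum>x\<in>UNIV. f x * h x)"
proof -
  have "(\<Sum>y\<in>UNIV. (\<Sum>x\<in>UNIV. gu y x * f x) * (\<Sum>z\<in>UNIV. g $ y $ z * h z))
      = (\<Sum>y\<in>UNIV. \<Sum>x\<in>UNIV. f x * (gu x y * (\<Sum>z\<in>UNIV. g $ y $ z * h z)))"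
    by (simp add: sum_distrib_right gu_sym mult_ac)
  also have "\<dots> = (\<Sum>x\<in>UNIV. f x * (\<Sum>y\<in>UNIV. gu x y * (\<Sum>z\<in>UNIV. g $ y $ z * h z)))"
    by (subst sum.swap) (simp add: sum_distrib_left)
  finally show ?thesis
    by (simp add: raise_lower)
qed

lemma eps_antisym:
  "eps \<beta> \<alpha> \<kappa> \<tau> = - eps \<alpha> \<beta> \<kappa> \<tau>" "eps \<alpha> \<kappa> \<beta> \<tau> = - eps \<alpha> \<beta> \<kappa> \<tau>" "eps \<alpha> \<beta> \<tau> \<kappa> = - eps \<alpha> \<beta> \<kappa> \<tau>"
  using levi_civita_eps unfolding levi_civita_def by blast+

lemma eps4_antisym:
  "eps4 \<beta> \<alpha> \<kappa> \<tau> = - eps4 \<alpha> \<beta> \<kappa> \<tau>" "eps4 \<alpha> \<kappa> \<beta> \<tau> = - eps4 \<alpha> \<beta> \<kappa> \<tau>" "eps4 \<alpha> \<beta> \<tau> \<kappa> = - eps4 \<alpha> \<beta> \<kappa> \<tau>"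
proof -
  show "eps4 \<beta> \<alpha> \<kappa> \<tau> = - eps4 \<alpha> \<beta> \<kappa> \<tau>"
    unfolding eps_up4_def by (subst sum.swap, subst eps_antisym(1)) (simp add: sum_negf mult_ac)
  show "eps4 \<alpha> \<kappa> \<beta> \<tau> = - eps4 \<alpha> \<beta> \<kappa> \<tau>"
    unfolding eps_up4_def
    by (rule trans, rule sum.cong[OF refl], rule sum.swap, subst eps_antisym(2)) (simp add: sum_negf mult_ac)
  show "eps4 \<alpha> \<beta> \<tau> \<kappa> = - eps4 \<alpha> \<beta> \<kappa> \<tau>"
    unfolding eps_up4_def
    by (rule trans, rule sum.cong[OF refl], rule sum.cong[OF refl], rule sum.swap, subst eps_antisym(3))
      (simp add: sum_negf mult_ac)
qed

lemma eps2_antisym: "eps2 \<beta> \<alpha> \<kappa> \<tau> = - eps2 \<alpha> \<beta> \<kappa> \<tau>" "eps2 \<alpha> \<beta> \<tau> \<kappa> = - eps2 \<alpha> \<beta> \<kappa> \<tau>"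
proof -
  show "eps2 \<beta> \<alpha> \<kappa> \<tau> = - eps2 \<alpha> \<beta> \<kappa> \<tau>"
    unfolding eps_up2_def by (subst sum.swap, subst eps_antisym(1)) (simp add: sum_negf mult_ac)
  show "eps2 \<alpha> \<beta> \<tau> \<kappa> = - eps2 \<alpha> \<beta> \<kappa> \<tau>"
    unfolding eps_up2_def by (subst eps_antisym(3)) (simp add: sum_negf)
qed

text \<open>The factor \<open>fact 4\<close> cancels the normalization of
  \<open>antisym_delta\<close>; what remains is a determinant, expanded along the row of \<kappa>,
  with \<open>kd3\<close> as the minors.\<close>

lemma eps_eps4:
  "eps \<alpha> \<beta> \<gamma> \<delta> * eps4 \<kappa> \<tau> \<rho> \<sigma> =
    sg * (kd \<alpha> \<kappa> * kd3 \<beta> \<gamma> \<delta> \<tau> \<rho> \<sigma> - kd \<beta> \<kappa> * kd3 \<alpha> \<gamma> \<delta> \<tau> \<rho> \<sigma>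
        + kd \<gamma> \<kappa> * kd3 \<alpha> \<beta> \<delta> \<tau> \<rho> \<sigma> - kd \<delta> \<kappa> * kd3 \<alpha> \<beta> \<gamma> \<tau> \<rho> \<sigma>)"
proof -
  have "eps \<alpha> \<beta> \<gamma> \<delta> * eps4 \<kappa> \<tau> \<rho> \<sigma> = sg * fact 4 * antisym_delta (quad \<kappa> \<tau> \<rho> \<sigma>) (quad \<alpha> \<beta> \<gamma> \<delta>)"
    using levi_civita_eps unfolding levi_civita_def quad_simps[symmetric] by (metis quad_simps)
  then have "eps \<alpha> \<beta> \<gamma> \<delta> * eps4 \<kappa> \<tau> \<rho> \<sigma> = sg * det (\<chi> i j. kd (quad \<kappa> \<tau> \<rho> \<sigma> i) (quad \<alpha> \<beta> \<gamma> \<delta> j))"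
    by (simp add: antisym_delta_eq_det)
  also have "det (\<chi> i j. kd (quad \<kappa> \<tau> \<rho> \<sigma> i) (quad \<alpha> \<beta> \<gamma> \<delta> j)) =
      kd \<alpha> \<kappa> * kd3 \<beta> \<gamma> \<delta> \<tau> \<rho> \<sigma> - kd \<beta> \<kappa> * kd3 \<alpha> \<gamma> \<delta> \<tau> \<rho> \<sigma>
        + kd \<gamma> \<kappa> * kd3 \<alpha> \<beta> \<delta> \<tau> \<rho> \<sigma> - kd \<delta> \<kappa> * kd3 \<alpha> \<beta> \<gamma> \<tau> \<rho> \<sigma>"
    by (simp add: det_4 quad_simps kd3_def kd_commute algebra_simps)
  finally show ?thesis .
qed

text \<open>The trace of the delta contributes 4 copies of \<open>kd3\<close> and each of the other
  three terms takes one away: 4 - 3 = 1. In the two contractions that follow the same count gives 4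
  - 2 = 2 and 2 * (4 - 1) = 6.\<close>

lemma eps_eps4_contract1:
  "(\<Sum>x\<in>UNIV. eps x \<beta> \<gamma> \<delta> * eps4 x \<tau> \<rho> \<sigma>) = sg * kd3 \<beta> \<gamma> \<delta> \<tau> \<rho> \<sigma>"
proof -
  have [simp]: "(\<Sum>x\<in>UNIV. kd x x) = 4" by (simp add: kd_def)
  show ?thesis
    unfolding eps_eps4 kd3_def sum_distrib_left[symmetric]
    by (simp add: algebra_simps sum.distrib sum_subtractf flip: sum_distrib_left sum_distrib_right)
qed

lemma eps_eps4_contract2:
  "(\<Sum>x\<in>UNIV. \<Sum>y\<in>UNIV. eps x y \<gamma> \<delta> * eps4 x y \<rho> \<sigma>) = 2 * sg * (kd \<gamma> \<rho> * kd \<delta> \<sigma> - kd \<gamma> \<sigma> * kd \<delta> \<rho>)"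
proof -
  have [simp]: "(\<Sum>x\<in>UNIV. kd x x) = 4" by (simp add: kd_def)
  show ?thesis
    by (subst sum.swap) (simp add: eps_eps4_contract1 kd3_def algebra_simps sum.distrib sum_subtractf
      flip: sum_distrib_left sum_distrib_right)
qed

lemma eps_eps4_contract3:
  "(\<Sum>x\<in>UNIV. \<Sum>y\<in>UNIV. \<Sum>z\<in>UNIV. eps x y z \<delta> * eps4 x y z \<sigma>) = 6 * sg * kd \<delta> \<sigma>"
proof -
  have [simp]: "(\<Sum>x\<in>UNIV. kd x x) = 4" by (simp add: kd_def)
  have "(\<Sum>x\<in>UNIV. \<Sum>y\<in>UNIV. \<Sum>z\<in>UNIV. eps x y z \<delta> * eps4 x y z \<sigma>)
      = (\<Sum>z\<in>UNIV. \<Sum>x\<in>UNIV. \<Sum>y\<in>UNIV. eps x y z \<delta> * eps4 x y z \<sigma>)"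
    by (subst (2) sum.swap, subst sum.swap) simp
  then show ?thesis
    by (simp add: eps_eps4_contract2 algebra_simps sum_subtractf
      flip: sum_distrib_left sum_distrib_right)
qed

lemma eps2_conv_up1: "eps2 \<beta> \<gamma> \<alpha> \<mu> = (\<Sum>x\<in>UNIV. gu \<gamma> x * eps_up1 g eps \<beta> x \<alpha> \<mu>)"
  unfolding eps_up2_def eps_up1_def
  by (subst sum.swap) (simp add: sum_distrib_left mult_ac)

lemma eps4_conv_eps2: "eps4 \<kappa> \<tau> \<rho> \<sigma> = (\<Sum>x\<in>UNIV. gu \<rho> x * (\<Sum>y\<in>UNIV. gu \<sigma> y * eps2 \<kappa> \<tau> x y))"
proof -
  have "eps4 \<kappa> \<tau> \<rho> \<sigma> = (\<Sum>\<alpha>\<in>UNIV. \<Sum>\<gamma>\<in>UNIV. \<Sum>\<delta>\<in>UNIV. \<Sum>\<beta>\<in>UNIV.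
        gu \<kappa> \<alpha> * gu \<tau> \<beta> * gu \<rho> \<gamma> * gu \<sigma> \<delta> * eps \<alpha> \<beta> \<gamma> \<delta>)"
    unfolding eps_up4_def by (subst (2) sum.swap, subst (3) sum.swap) simp
  also have "\<dots> = (\<Sum>\<gamma>\<in>UNIV. \<Sum>\<delta>\<in>UNIV. \<Sum>\<alpha>\<in>UNIV. \<Sum>\<beta>\<in>UNIV.
        gu \<kappa> \<alpha> * gu \<tau> \<beta> * gu \<rho> \<gamma> * gu \<sigma> \<delta> * eps \<alpha> \<beta> \<gamma> \<delta>)"
    by (subst sum.swap, subst (2) sum.swap) simp
  finally show ?thesis
    by (simp add: eps_up2_def sum_distrib_left mult_ac)
qed

lemma lower_eps4: "(\<Sum>z\<in>UNIV. g $ \<alpha> $ z * eps4 \<kappa> \<tau> \<rho> z) = (\<Sum>x\<in>UNIV. gu \<rho> x * eps2 \<kappa> \<tau> x \<alpha>)"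
proof -
  have "eps4 \<kappa> \<tau> \<rho> z = (\<Sum>y\<in>UNIV. gu z y * (\<Sum>x\<in>UNIV. gu \<rho> x * eps2 \<kappa> \<tau> x y))" for z
    unfolding eps4_conv_eps2 by (simp add: sum_distrib_left, subst sum.swap) (simp add: mult_ac)
  then show ?thesis
    by (simp add: lower_raise)
qed

text \<open>Two raised indices are the same as four raised and two lowered again. In a product of
  two \<open>eps2\<close> one factor can thus be traded for \<open>eps4\<close>.\<close>

lemma eps2_conv_lower:
  "eps2 \<kappa> \<tau> \<rho> \<alpha> = (\<Sum>x\<in>UNIV. g $ \<rho> $ x * (\<Sum>z\<in>UNIV. g $ \<alpha> $ z * eps4 \<kappa> \<tau> x z))"
  by (simp add: lower_eps4 lower_raise)

text \<open>The mixed form that occurs in the fourth trace once its free index is lowered, as in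
  \<open>tr4_eq\<close>.\<close>

definition eps_low1 :: tensor4 where
  "eps_low1 \<mu> \<kappa> \<nu> \<tau> = (\<Sum>x\<in>UNIV. g $ \<mu> $ x * eps4 x \<kappa> \<nu> \<tau>)"

lemma eps_low1_antisym: "eps_low1 \<mu> \<nu> \<kappa> \<tau> = - eps_low1 \<mu> \<kappa> \<nu> \<tau>" "eps_low1 \<mu> \<kappa> \<tau> \<nu> = - eps_low1 \<mu> \<kappa> \<nu> \<tau>"
  unfolding eps_low1_def
  by (subst eps4_antisym(2), simp add: sum_negf) (subst eps4_antisym(3), simp add: sum_negf)

lemma eps2_raise: "(\<Sum>x\<in>UNIV. gu \<rho> x * eps2 \<kappa> \<tau> x \<mu>) = - eps_low1 \<mu> \<kappa> \<tau> \<rho>"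
proof -
  \<comment> \<open>Moving the last index to the front takes three transpositions.\<close>
  have "eps4 \<kappa> \<tau> \<rho> z = - eps4 z \<kappa> \<tau> \<rho>" for z
    by (metis eps4_antisym(1,2,3) minus_minus)
  then show ?thesis
    unfolding lower_eps4[symmetric] eps_low1_def by (simp add: sum_negf)
qed

lemma tr4_eq: "tr g eps 4 N \<mu> = (\<Sum>\<kappa>\<in>UNIV. \<Sum>\<nu>\<in>UNIV. \<Sum>\<tau>\<in>UNIV. eps_low1 \<mu> \<kappa> \<nu> \<tau> * N \<kappa> \<nu> \<tau>)"
proof -
  have "tr g eps 4 N \<mu> = (\<Sum>x\<in>UNIV. \<Sum>\<kappa>\<in>UNIV. \<Sum>\<nu>\<in>UNIV. \<Sum>\<tau>\<in>UNIV. g $ \<mu> $ x * eps4 x \<kappa> \<nu> \<tau> * N \<kappa> \<nu> \<tau>)"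
    by (simp add: tr_def lower1_def sum_distrib_left mult_ac)
  also have "\<dots> = (\<Sum>\<kappa>\<in>UNIV. \<Sum>\<nu>\<in>UNIV. \<Sum>x\<in>UNIV. \<Sum>\<tau>\<in>UNIV. g $ \<mu> $ x * eps4 x \<kappa> \<nu> \<tau> * N \<kappa> \<nu> \<tau>)"
    by (subst sum.swap, subst (2) sum.swap) simp
  also have "\<dots> = (\<Sum>\<kappa>\<in>UNIV. \<Sum>\<nu>\<in>UNIV. \<Sum>\<tau>\<in>UNIV. \<Sum>x\<in>UNIV. g $ \<mu> $ x * eps4 x \<kappa> \<nu> \<tau> * N \<kappa> \<nu> \<tau>)"
    by (subst (3) sum.swap) simp
  finally show ?thesis
    by (simp add: eps_low1_def sum_distrib_right)
qed

text \<open>The first two groups of terms pair an inverse metric with a metric. Applied to a rank-3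
  array they produce its traces, the source of all trace corrections in the solution.\<close>

lemma eps2_eps2_contract1:
  "(\<Sum>\<gamma>\<in>UNIV. eps2 \<beta> \<gamma> \<alpha> \<mu> * eps2 \<kappa> \<tau> \<gamma> \<nu>) =
    - sg * (gu \<beta> \<kappa> * (kd \<alpha> \<tau> * g $ \<nu> $ \<mu> - kd \<mu> \<tau> * g $ \<nu> $ \<alpha>)
          - gu \<beta> \<tau> * (kd \<alpha> \<kappa> * g $ \<nu> $ \<mu> - kd \<mu> \<kappa> * g $ \<nu> $ \<alpha>)
          + kd \<beta> \<nu> * (kd \<alpha> \<kappa> * kd \<mu> \<tau> - kd \<alpha> \<tau> * kd \<mu> \<kappa>))"
proof -
  \<comment> \<open>Bringing the summed index y to the front costs one transposition in
    \<open>eps\<close> and two in \<open>eps4\<close>, whence the minus sign in front of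
    \<open>sg\<close>.\<close>
  have cyc: "eps x y \<alpha> \<mu> * eps4 \<kappa> \<tau> y z = - (eps y x \<alpha> \<mu> * eps4 y \<kappa> \<tau> z)" for x y z
    by (metis eps_antisym(1) eps4_antisym(1,2) minus_minus mult_minus_left)
  have "(\<Sum>\<gamma>\<in>UNIV. eps2 \<beta> \<gamma> \<alpha> \<mu> * eps2 \<kappa> \<tau> \<gamma> \<nu>)
      = (\<Sum>y\<in>UNIV. (\<Sum>x\<in>UNIV. gu \<beta> x * eps x y \<alpha> \<mu>) * (\<Sum>z\<in>UNIV. g $ \<nu> $ z * eps4 \<kappa> \<tau> y z))"
    unfolding eps2_conv_up1[of \<beta>] eps2_conv_lower[of \<kappa>] contract_raise_lower eps_up1_def ..
  also have "\<dots> = (\<Sum>y\<in>UNIV. \<Sum>x\<in>UNIV. \<Sum>z\<in>UNIV. gu \<beta> x * (g $ \<nu> $ z * (eps x y \<alpha> \<mu> * eps4 \<kappa> \<tau> y z)))"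
    by (simp add: sum_product mult_ac)
  also have "\<dots> = (\<Sum>x\<in>UNIV. \<Sum>z\<in>UNIV. \<Sum>y\<in>UNIV. gu \<beta> x * (g $ \<nu> $ z * (eps x y \<alpha> \<mu> * eps4 \<kappa> \<tau> y z)))"
    by (subst sum.swap, subst (2) sum.swap) simp
  also have "\<dots> = (\<Sum>x\<in>UNIV. gu \<beta> x * (\<Sum>z\<in>UNIV. g $ \<nu> $ z * (- sg * kd3 x \<alpha> \<mu> \<kappa> \<tau> z)))"
    by (simp add: cyc sum_negf eps_eps4_contract1 flip: sum_distrib_left)
  also have "\<dots> = - sg * (\<Sum>x\<in>UNIV. gu \<beta> x * (kd x \<kappa> * (kd \<alpha> \<tau> * g $ \<nu> $ \<mu> - kd \<mu> \<tau> * g $ \<nu> $ \<alpha>)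
          - kd x \<tau> * (kd \<alpha> \<kappa> * g $ \<nu> $ \<mu> - kd \<mu> \<kappa> * g $ \<nu> $ \<alpha>)
          + g $ x $ \<nu> * (kd \<alpha> \<kappa> * kd \<mu> \<tau> - kd \<alpha> \<tau> * kd \<mu> \<kappa>)))"
  proof -
    have "(\<Sum>z\<in>UNIV. g $ \<nu> $ z * (- sg * kd3 x \<alpha> \<mu> \<kappa> \<tau> z)) = - sg * (\<Sum>z\<in>UNIV. g $ \<nu> $ z * kd3 x \<alpha> \<mu> \<kappa> \<tau> z)" for x
      by (simp add: sum_distrib_left mult_ac)
    moreover have "(\<Sum>z\<in>UNIV. g $ \<nu> $ z * kd3 x \<alpha> \<mu> \<kappa> \<tau> z) = kd x \<kappa> * (kd \<alpha> \<tau> * g $ \<nu> $ \<mu> - kd \<mu> \<tau> * g $ \<nu> $ \<alpha>)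
          - kd x \<tau> * (kd \<alpha> \<kappa> * g $ \<nu> $ \<mu> - kd \<mu> \<kappa> * g $ \<nu> $ \<alpha>)
          + g $ x $ \<nu> * (kd \<alpha> \<kappa> * kd \<mu> \<tau> - kd \<alpha> \<tau> * kd \<mu> \<kappa>)" for x
      by (simp add: kd3_def g_sym[of x] sum.distrib sum_subtractf algebra_simps flip: sum_distrib_left sum_distrib_right)
    ultimately show ?thesis
      by (simp add: sum_distrib_left mult_ac)
  qed
  also have "\<dots> = - sg * ((\<Sum>x\<in>UNIV. gu \<beta> x * kd x \<kappa>) * (kd \<alpha> \<tau> * g $ \<nu> $ \<mu> - kd \<mu> \<tau> * g $ \<nu> $ \<alpha>)
          - (\<Sum>x\<in>UNIV. gu \<beta> x * kd x \<tau>) * (kd \<alpha> \<kappa> * g $ \<nu> $ \<mu> - kd \<mu> \<kappa> * g $ \<nu> $ \<alpha>)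
          + (\<Sum>x\<in>UNIV. gu \<beta> x * g $ x $ \<nu>) * (kd \<alpha> \<kappa> * kd \<mu> \<tau> - kd \<alpha> \<tau> * kd \<mu> \<kappa>))"
    unfolding sum_distrib_right by (simp only: sum.distrib sum_subtractf right_diff_distrib distrib_left mult.assoc)
  finally show ?thesis
    by (simp add: gu_g)
qed

text \<open>Contracting a second pair in the previous identity: the trace of the delta gives 4, the
  terms with metrics take away 2, and the swap of \<beta> and \<gamma> removes the sign.\<close>

lemma eps2_eps2_contract2:
  "(\<Sum>\<beta>\<in>UNIV. \<Sum>\<gamma>\<in>UNIV. eps2 \<beta> \<gamma> \<alpha> \<mu> * eps2 \<kappa> \<tau> \<beta> \<gamma>) = 2 * sg * (kd \<alpha> \<kappa> * kd \<mu> \<tau> - kd \<alpha> \<tau> * kd \<mu> \<kappa>)"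
proof -
  have kd4: "(\<Sum>x\<in>UNIV. kd x x) = 4" by (simp add: kd_def)
  have "(\<Sum>\<beta>\<in>UNIV. \<Sum>\<gamma>\<in>UNIV. eps2 \<beta> \<gamma> \<alpha> \<mu> * eps2 \<kappa> \<tau> \<beta> \<gamma>) =
    (\<Sum>\<beta>\<in>UNIV. - (\<Sum>\<gamma>\<in>UNIV. eps2 \<beta> \<gamma> \<alpha> \<mu> * eps2 \<kappa> \<tau> \<gamma> \<beta>))"
    by (subst eps2_antisym(2)) (simp add: sum_negf)
  also have "\<dots> = sg * ((\<Sum>\<beta>\<in>UNIV. gu \<kappa> \<beta> * g $ \<beta> $ \<mu>) * kd \<alpha> \<tau> - (\<Sum>\<beta>\<in>UNIV. gu \<kappa> \<beta> * g $ \<beta> $ \<alpha>) * kd \<mu> \<tau>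
      - (\<Sum>\<beta>\<in>UNIV. gu \<tau> \<beta> * g $ \<beta> $ \<mu>) * kd \<alpha> \<kappa> + (\<Sum>\<beta>\<in>UNIV. gu \<tau> \<beta> * g $ \<beta> $ \<alpha>) * kd \<mu> \<kappa>
      + (\<Sum>\<beta>\<in>UNIV. kd \<beta> \<beta>) * (kd \<alpha> \<kappa> * kd \<mu> \<tau> - kd \<alpha> \<tau> * kd \<mu> \<kappa>))"
    unfolding eps2_eps2_contract1
    by (simp add: sum_distrib_right sum_distrib_left sum.distrib sum_subtractf gu_sym algebra_simps)
  finally show ?thesis
    unfolding gu_g kd4 by (simp add: kd_commute algebra_simps)
qed

lemma eps_low1_eps2_contract2:
  "(\<Sum>\<nu>\<in>UNIV. \<Sum>\<tau>\<in>UNIV. eps_low1 \<mu> \<kappa> \<nu> \<tau> * eps2 x y \<nu> \<tau>) = 2 * sg * (kd x \<mu> * gu y \<kappa> - gu x \<kappa> * kd y \<mu>)"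
proof -
  \<comment> \<open>Exchanging two pairs of indices is an even permutation, so no sign
    appears.\<close>
  have move: "eps a b \<nu> \<tau> * eps4 z \<kappa> \<nu> \<tau> = eps \<nu> \<tau> a b * eps4 \<nu> \<tau> z \<kappa>" for a b z \<nu> \<tau>
    by (metis eps_antisym(1,2,3) eps4_antisym(1,2,3) minus_minus)
  have "(\<Sum>\<nu>\<in>UNIV. \<Sum>\<tau>\<in>UNIV. eps_low1 \<mu> \<kappa> \<nu> \<tau> * eps2 x y \<nu> \<tau>)
      = (\<Sum>\<nu>\<in>UNIV. \<Sum>\<tau>\<in>UNIV. \<Sum>a\<in>UNIV. \<Sum>b\<in>UNIV. \<Sum>z\<in>UNIV.
          gu x a * (gu y b * (g $ \<mu> $ z * (eps a b \<nu> \<tau> * eps4 z \<kappa> \<nu> \<tau>))))"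
    by (simp add: eps_low1_def eps_up2_def sum_product sum_distrib_left mult_ac)
  also have "\<dots> = (\<Sum>a\<in>UNIV. \<Sum>b\<in>UNIV. \<Sum>z\<in>UNIV. \<Sum>\<nu>\<in>UNIV. \<Sum>\<tau>\<in>UNIV.
          gu x a * (gu y b * (g $ \<mu> $ z * (eps a b \<nu> \<tau> * eps4 z \<kappa> \<nu> \<tau>))))"
    \<comment> \<open>The sums over \<nu> and \<tau> are carried inward past those over a, b and z
      in turn, \<tau> always moving first.\<close>
    by (subst (2) sum.swap, subst sum.swap, subst (3) sum.swap, subst (2) sum.swap,
        subst (4) sum.swap, subst (3) sum.swap) (rule refl)
  also have "\<dots> = 2 * sg * ((\<Sum>a\<in>UNIV. gu x a * g $ a $ \<mu>) * gu y \<kappa> - gu x \<kappa> * (\<Sum>b\<in>UNIV. gu y b * g $ b $ \<mu>))"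
  proof -
    have z: "(\<Sum>z\<in>UNIV. g $ \<mu> $ z * (2 * sg * (kd a z * kd b \<kappa> - kd a \<kappa> * kd b z)))
        = 2 * sg * (kd b \<kappa> * g $ a $ \<mu> - kd a \<kappa> * g $ b $ \<mu>)" for a b
      by (simp add: g_sym[of \<mu>] algebra_simps sum_subtractf flip: sum_distrib_left sum_distrib_right)
    have b: "(\<Sum>b\<in>UNIV. gu y b * (2 * sg * (kd b \<kappa> * g $ a $ \<mu> - kd a \<kappa> * g $ b $ \<mu>)))
        = 2 * sg * (gu y \<kappa> * g $ a $ \<mu> - kd a \<kappa> * (\<Sum>b\<in>UNIV. gu y b * g $ b $ \<mu>))" for a
      by (simp add: algebra_simps sum_subtractf flip: sum_distrib_left sum_distrib_right)
        (simp add: sum_distrib_left mult_ac)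
    show ?thesis
      by (simp add: move eps_eps4_contract2 z b flip: sum_distrib_left)
        (simp add: algebra_simps sum_subtractf flip: sum_distrib_left sum_distrib_right,
         simp add: sum_distrib_left mult_ac)
  qed
  finally show ?thesis
    by (simp add: gu_g)
qed

lemma eps_low1_eps_contract3:
  "(\<Sum>\<kappa>\<in>UNIV. \<Sum>\<nu>\<in>UNIV. \<Sum>\<tau>\<in>UNIV. eps_low1 \<mu> \<kappa> \<nu> \<tau> * eps \<rho> \<kappa> \<nu> \<tau>) = 6 * sg * g $ \<mu> $ \<rho>"
proof -
  \<comment> \<open>A cyclic shift of four indices is odd; it is made in both factors, so the signs
    cancel.\<close>
  have move: "eps \<rho> \<kappa> \<nu> \<tau> * eps4 z \<kappa> \<nu> \<tau> = eps \<kappa> \<nu> \<tau> \<rho> * eps4 \<kappa> \<nu> \<tau> z" for z \<kappa> \<nu> \<tau>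
    by (metis eps_antisym(1,2,3) eps4_antisym(1,2,3) minus_mult_minus)
  have "(\<Sum>\<kappa>\<in>UNIV. \<Sum>\<nu>\<in>UNIV. \<Sum>\<tau>\<in>UNIV. eps_low1 \<mu> \<kappa> \<nu> \<tau> * eps \<rho> \<kappa> \<nu> \<tau>)
      = (\<Sum>\<kappa>\<in>UNIV. \<Sum>\<nu>\<in>UNIV. \<Sum>\<tau>\<in>UNIV. \<Sum>z\<in>UNIV. g $ \<mu> $ z * (eps \<rho> \<kappa> \<nu> \<tau> * eps4 z \<kappa> \<nu> \<tau>))"
    by (simp add: eps_low1_def sum_distrib_left sum_distrib_right mult_ac)
  also have "\<dots> = (\<Sum>z\<in>UNIV. \<Sum>\<kappa>\<in>UNIV. \<Sum>\<nu>\<in>UNIV. \<Sum>\<tau>\<in>UNIV. g $ \<mu> $ z * (eps \<rho> \<kappa> \<nu> \<tau> * eps4 z \<kappa> \<nu> \<tau>))"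
    by (subst (3) sum.swap, subst (2) sum.swap, subst sum.swap) (rule refl)
  also have "\<dots> = 6 * sg * (\<Sum>z\<in>UNIV. g $ \<mu> $ z * kd z \<rho>)"
    by (simp add: move eps_eps4_contract3 kd_commute flip: sum_distrib_left)
      (simp add: mult_ac flip: sum_distrib_left)
  finally show ?thesis
    by simp
qed

subsection \<open>Traces and parity-odd contractions\<close>

lemma oddc_antisym: "oddc g eps i N \<kappa> \<beta> \<alpha> = - oddc g eps i N \<kappa> \<alpha> \<beta>"
  unfolding oddc_def by (subst (1 2 3) eps2_antisym(2)) (simp add: sum_negf)

lemma oddc_1_swap: "oddc g eps 1 (\<lambda>x y z. N y x z) \<kappa> \<alpha> \<beta> = - oddc g eps 1 N \<kappa> \<alpha> \<beta>"
  unfolding oddc_def by (simp, subst sum.swap, subst eps2_antisym(1)) (simp add: sum_negf)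

text \<open>A metric trace depends only on which two slots are contracted, as \<open>gu\<close> is
  symmetric. Hence permuting the slots permutes the three traces, whereas the fourth trace takes the
  sign of the permutation.\<close>

lemma tr_perm:
  "tr g eps 1 (\<lambda>x y z. N z x y) = tr g eps 3 N"
  "tr g eps 1 (\<lambda>x y z. N y z x) = tr g eps 2 N"
  "tr g eps 1 (\<lambda>x y z. N x z y) = tr g eps 2 N"
  "tr g eps 1 (\<lambda>x y z. N z y x) = tr g eps 3 N"
  "tr g eps 1 (\<lambda>x y z. N y x z) = tr g eps 1 N"
  "tr g eps 2 (\<lambda>x y z. N z x y) = tr g eps 1 N"
  "tr g eps 2 (\<lambda>x y z. N y z x) = tr g eps 3 N"
  "tr g eps 2 (\<lambda>x y z. N x z y) = tr g eps 1 N"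
  "tr g eps 2 (\<lambda>x y z. N z y x) = tr g eps 2 N"
  "tr g eps 2 (\<lambda>x y z. N y x z) = tr g eps 3 N"
  "tr g eps 3 (\<lambda>x y z. N z x y) = tr g eps 2 N"
  "tr g eps 3 (\<lambda>x y z. N y z x) = tr g eps 1 N"
  "tr g eps 3 (\<lambda>x y z. N x z y) = tr g eps 3 N"
  "tr g eps 3 (\<lambda>x y z. N z y x) = tr g eps 1 N"
  "tr g eps 3 (\<lambda>x y z. N y x z) = tr g eps 2 N"
  by (intro ext, simp add: tr_def; fail |
      intro ext, simp add: tr_def, subst sum.swap, simp add: gu_sym; fail)+

lemma tr_4_swap12: "tr g eps 4 (\<lambda>x y z. N y x z) = (\<lambda>\<mu>. - tr g eps 4 N \<mu>)"
  unfolding tr4_eq by (intro ext, subst sum.swap, subst eps_low1_antisym(1)) (simp add: sum_negf)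

lemma tr_4_swap23: "tr g eps 4 (\<lambda>x y z. N x z y) = (\<lambda>\<mu>. - tr g eps 4 N \<mu>)"
  unfolding tr4_eq by (intro ext, subst (2) sum.swap, subst eps_low1_antisym(2)) (simp add: sum_negf)

lemma tr_4_perm:
  "tr g eps 4 (\<lambda>x y z. N z x y) = tr g eps 4 N"
  "tr g eps 4 (\<lambda>x y z. N y z x) = tr g eps 4 N"
  "tr g eps 4 (\<lambda>x y z. N z y x) = (\<lambda>\<mu>. - tr g eps 4 N \<mu>)"
  using tr_4_swap12[of "\<lambda>x y z. N x z y"] tr_4_swap12[of "\<lambda>x y z. N z x y"]
    tr_4_swap23[of "\<lambda>x y z. N y x z"] tr_4_swap12[of N] tr_4_swap23[of N]
  by simp_all

lemma tr_mult_metric: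
  "tr g eps 1 (\<lambda>x y z. X y * g $ x $ z) \<mu> = X \<mu>"
  "tr g eps 1 (\<lambda>x y z. X z * g $ x $ y) \<mu> = 4 * X \<mu>"
  "tr g eps 1 (\<lambda>x y z. X x * g $ y $ z) \<mu> = X \<mu>"
proof -
  have "tr g eps 1 (\<lambda>x y z. X y * g $ x $ z) \<mu> = (\<Sum>y\<in>UNIV. X y * (\<Sum>x\<in>UNIV. gu y x * g $ x $ \<mu>))"
    unfolding tr_def by (simp, subst sum.swap) (simp add: sum_distrib_left gu_sym mult_ac)
  then show "tr g eps 1 (\<lambda>x y z. X y * g $ x $ z) \<mu> = X \<mu>"
    by (simp add: gu_g)
  have "tr g eps 1 (\<lambda>x y z. X z * g $ x $ y) \<mu> = X \<mu> * (\<Sum>x\<in>UNIV. \<Sum>y\<in>UNIV. g $ x $ y * gu y x)"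
    unfolding tr_def by (simp add: sum_distrib_left gu_sym mult_ac)
  then show "tr g eps 1 (\<lambda>x y z. X z * g $ x $ y) \<mu> = 4 * X \<mu>"
    by (simp add: g_gu) (simp add: kd_def)
  have "tr g eps 1 (\<lambda>x y z. X x * g $ y $ z) \<mu> = (\<Sum>x\<in>UNIV. X x * (\<Sum>y\<in>UNIV. gu x y * g $ y $ \<mu>))"
    unfolding tr_def by (simp add: sum_distrib_left gu_sym mult_ac)
  then show "tr g eps 1 (\<lambda>x y z. X x * g $ y $ z) \<mu> = X \<mu>"
    by (simp add: gu_g)
qed

lemma tr_4_metric_zero: "tr g eps 4 (\<lambda>x y z. X z * g $ x $ y) = (\<lambda>\<mu>. 0)"
proof
  fix \<mu>
  have "tr g eps 4 (\<lambda>x y z. X z * g $ x $ y) \<mu> = - tr g eps 4 (\<lambda>x y z. X z * g $ x $ y) \<mu>"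
    using tr_4_swap12[of "\<lambda>x y z. X z * g $ x $ y"] by (simp add: g_sym fun_eq_iff)
  then show "tr g eps 4 (\<lambda>x y z. X z * g $ x $ y) \<mu> = 0" by simp
qed

text \<open>These are the coefficients of \<open>a7\<close>, \<open>a8\<close>, \<open>a9\<close>
  and \<open>c\<close> in \<open>Gmat\<close>: 4 where the contracted slots are those of the metric,
  and 0 against the pseudo-tensor because the metric is symmetric. Traces 2 and 3 reduce to trace 1
  by permuting slots.\<close>

lemma tr_metric:
  "tr g eps 1 (\<lambda>x y z. X y * g $ x $ z) \<mu> = X \<mu>"
  "tr g eps 1 (\<lambda>x y z. X z * g $ x $ y) \<mu> = 4 * X \<mu>"
  "tr g eps 1 (\<lambda>x y z. X x * g $ y $ z) \<mu> = X \<mu>"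
  "tr g eps 2 (\<lambda>x y z. X y * g $ x $ z) \<mu> = 4 * X \<mu>"
  "tr g eps 2 (\<lambda>x y z. X z * g $ x $ y) \<mu> = X \<mu>"
  "tr g eps 2 (\<lambda>x y z. X x * g $ y $ z) \<mu> = X \<mu>"
  "tr g eps 3 (\<lambda>x y z. X y * g $ x $ z) \<mu> = X \<mu>"
  "tr g eps 3 (\<lambda>x y z. X z * g $ x $ y) \<mu> = X \<mu>"
  "tr g eps 3 (\<lambda>x y z. X x * g $ y $ z) \<mu> = 4 * X \<mu>"
  "tr g eps 4 (\<lambda>x y z. X y * g $ x $ z) \<mu> = 0"
  "tr g eps 4 (\<lambda>x y z. X z * g $ x $ y) \<mu> = 0"
  "tr g eps 4 (\<lambda>x y z. X x * g $ y $ z) \<mu> = 0"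
proof -
  let ?F = "\<lambda>x y z. X y * g $ x $ z" and ?G = "\<lambda>x y z. X z * g $ x $ y" and ?H = "\<lambda>x y z. X x * g $ y $ z"
  have sym: "(\<lambda>x y z. X y * g $ z $ x) = ?F" "(\<lambda>x y z. X z * g $ y $ x) = ?G" "(\<lambda>x y z. X x * g $ z $ y) = ?H"
    by (simp_all add: g_sym)
  show "tr g eps 1 ?F \<mu> = X \<mu>" "tr g eps 1 ?G \<mu> = 4 * X \<mu>" "tr g eps 1 ?H \<mu> = X \<mu>"
    by (fact tr_mult_metric)+
  show "tr g eps 2 ?F \<mu> = 4 * X \<mu>" "tr g eps 2 ?G \<mu> = X \<mu>" "tr g eps 2 ?H \<mu> = X \<mu>"
    unfolding tr_perm(3)[of ?F, symmetric] tr_perm(3)[of ?G, symmetric] tr_perm(3)[of ?H, symmetric] sym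
    by (fact tr_mult_metric)+
  show "tr g eps 3 ?F \<mu> = X \<mu>" "tr g eps 3 ?G \<mu> = X \<mu>" "tr g eps 3 ?H \<mu> = 4 * X \<mu>"
    unfolding tr_perm(4)[of ?F, symmetric] tr_perm(4)[of ?G, symmetric] tr_perm(4)[of ?H, symmetric] sym
    by (fact tr_mult_metric)+
  show 0: "tr g eps 4 ?G \<mu> = 0"
    by (simp only: tr_4_metric_zero)
  show "tr g eps 4 ?H \<mu> = 0"
    unfolding tr_4_perm(1)[of ?H, symmetric] by (fact 0)
  show "tr g eps 4 ?F \<mu> = 0"
    using tr_4_swap23[of ?G] 0 by simp
qed

text \<open>The source of the entries of \<open>Gmat\<close> with \<open>b\<close>. A metric trace
  of a contraction lets one pseudo-tensor survive and gives the fourth trace, or 0 on the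
  antisymmetric pair; the fourth trace contains two pseudo-tensors and returns to metric
  traces.\<close>

lemma tr_oddc:
  "tr g eps 1 (oddc g eps 1 N) \<mu> = - tr g eps 4 N \<mu>"
  "tr g eps 2 (oddc g eps 1 N) \<mu> = tr g eps 4 N \<mu>"
  "tr g eps 3 (oddc g eps 1 N) \<mu> = 0"
  "tr g eps 4 (oddc g eps 1 N) \<mu> = 2 * sg * (tr g eps 3 N \<mu> - tr g eps 2 N \<mu>)"
proof -
  show 1: "tr g eps 1 (oddc g eps 1 N) \<mu> = - tr g eps 4 N \<mu>" for \<mu>
  proof -
    have "tr g eps 1 (oddc g eps 1 N) \<mu> = (\<Sum>\<alpha>\<in>UNIV. \<Sum>\<beta>\<in>UNIV. \<Sum>x\<in>UNIV. \<Sum>y\<in>UNIV. N x y \<alpha> * (gu \<alpha> \<beta> * eps2 x y \<beta> \<mu>))"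
      unfolding tr_def oddc_def by (simp add: sum_distrib_right) (simp add: mult_ac)
    also have "\<dots> = (\<Sum>x\<in>UNIV. \<Sum>y\<in>UNIV. \<Sum>\<alpha>\<in>UNIV. \<Sum>\<beta>\<in>UNIV. N x y \<alpha> * (gu \<alpha> \<beta> * eps2 x y \<beta> \<mu>))"
      by (subst (2) sum.swap, subst sum.swap, subst (3) sum.swap, subst (2) sum.swap) (rule refl)
    also have "\<dots> = - tr g eps 4 N \<mu>"
      by (simp add: eps2_raise tr4_eq sum_negf flip: sum_distrib_left) (simp add: mult_ac)
    finally show ?thesis .
  qed
  have anti: "(\<lambda>x y z. oddc g eps 1 N x z y) = (\<lambda>x y z. - 1 * oddc g eps 1 N x y z)"
    by (intro ext, subst oddc_antisym) simp
  show "tr g eps 2 (oddc g eps 1 N) \<mu> = tr g eps 4 N \<mu>"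
    unfolding tr_perm(3)[of "oddc g eps 1 N", symmetric] anti tr_mult 1 by simp
  have "tr g eps 3 (oddc g eps 1 N) \<mu> = - 1 * tr g eps 3 (oddc g eps 1 N) \<mu>"
    using tr_perm(13)[of "oddc g eps 1 N"] tr_mult[of g eps 3 "- 1" "oddc g eps 1 N" \<mu>]
    unfolding anti by simp
  then show "tr g eps 3 (oddc g eps 1 N) \<mu> = 0" by simp
  have "tr g eps 4 (oddc g eps 1 N) \<mu>
      = (\<Sum>\<kappa>\<in>UNIV. \<Sum>\<nu>\<in>UNIV. \<Sum>\<tau>\<in>UNIV. \<Sum>x\<in>UNIV. \<Sum>y\<in>UNIV. N x y \<kappa> * (eps_low1 \<mu> \<kappa> \<nu> \<tau> * eps2 x y \<nu> \<tau>))"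
    unfolding tr4_eq oddc_def by (simp add: sum_distrib_left mult_ac)
  also have "\<dots> = (\<Sum>\<kappa>\<in>UNIV. \<Sum>x\<in>UNIV. \<Sum>y\<in>UNIV. \<Sum>\<nu>\<in>UNIV. \<Sum>\<tau>\<in>UNIV. N x y \<kappa> * (eps_low1 \<mu> \<kappa> \<nu> \<tau> * eps2 x y \<nu> \<tau>))"
    by (subst (3) sum.swap, subst (2) sum.swap, subst (4) sum.swap, subst (3) sum.swap) (rule refl)
  also have "\<dots> = (\<Sum>\<kappa>\<in>UNIV. \<Sum>x\<in>UNIV. \<Sum>y\<in>UNIV. N x y \<kappa> * (2 * sg * (kd x \<mu> * gu y \<kappa> - gu x \<kappa> * kd y \<mu>)))"
    by (simp only: eps_low1_eps2_contract2 flip: sum_distrib_left)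
  also have "\<dots> = (\<Sum>\<kappa>\<in>UNIV. \<Sum>x\<in>UNIV. \<Sum>y\<in>UNIV. 2 * sg * (N x y \<kappa> * gu y \<kappa> * kd x \<mu> - N x y \<kappa> * gu x \<kappa> * kd y \<mu>))"
    by (simp add: algebra_simps)
  also have "\<dots> = 2 * sg * (\<Sum>\<kappa>\<in>UNIV. (\<Sum>y\<in>UNIV. N \<mu> y \<kappa> * gu y \<kappa>) - (\<Sum>x\<in>UNIV. N x \<mu> \<kappa> * gu x \<kappa>))"
    by (simp add: sum_subtractf flip: sum_distrib_left sum_distrib_right)
  also have "\<dots> = 2 * sg * (tr g eps 3 N \<mu> - tr g eps 2 N \<mu>)"
    unfolding tr_def sum_subtractf by (subst (1 2) sum.swap) simp
  finally show "tr g eps 4 (oddc g eps 1 N) \<mu> = 2 * sg * (tr g eps 3 N \<mu> - tr g eps 2 N \<mu>)" .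
qed

text \<open>Total antisymmetry kills the metric traces. The 6 is the threefold contraction, and
  appears in the fourth row of \<open>Gmat\<close> as 2 times 3.\<close>

lemma tr_eps:
  "tr g eps 1 (\<lambda>\<alpha> \<mu> \<nu>. \<Sum>\<rho>\<in>UNIV. eps \<rho> \<alpha> \<mu> \<nu> * Z \<rho>) \<mu> = 0"
  "tr g eps 2 (\<lambda>\<alpha> \<mu> \<nu>. \<Sum>\<rho>\<in>UNIV. eps \<rho> \<alpha> \<mu> \<nu> * Z \<rho>) \<mu> = 0"
  "tr g eps 3 (\<lambda>\<alpha> \<mu> \<nu>. \<Sum>\<rho>\<in>UNIV. eps \<rho> \<alpha> \<mu> \<nu> * Z \<rho>) \<mu> = 0"
  "tr g eps 4 (\<lambda>\<alpha> \<mu> \<nu>. \<Sum>\<rho>\<in>UNIV. eps \<rho> \<alpha> \<mu> \<nu> * Z \<rho>) \<mu> = 6 * sg * lower1 g Z \<mu>"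
proof -
  define T where "T = (\<lambda>\<alpha> \<mu> \<nu>. \<Sum>\<rho>\<in>UNIV. eps \<rho> \<alpha> \<mu> \<nu> * Z \<rho>)"
  have T12: "T y x z = - T x y z" and T23: "T x z y = - T x y z" for x y z
    unfolding T_def by (subst eps_antisym(2), simp add: sum_negf) (subst eps_antisym(3), simp add: sum_negf)
  have T13: "T z y x = - T x y z" for x y z
    using T12[of y z x] T23[of y x z] T12[of x y z] by simp
  show "tr g eps 1 T \<mu> = 0" "tr g eps 2 T \<mu> = 0" "tr g eps 3 T \<mu> = 0"
    unfolding tr_def
    using trace_antisym_sym_zero[of "\<lambda>x y. T x y \<mu>" gu, OF T12 gu_sym]
      trace_antisym_sym_zero[of "\<lambda>x y. T x \<mu> y" gu, OF T13 gu_sym]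
      trace_antisym_sym_zero[of "\<lambda>x y. T \<mu> x y" gu, OF T23 gu_sym]
    by simp_all
  have "tr g eps 4 T \<mu> = (\<Sum>\<kappa>\<in>UNIV. \<Sum>\<nu>\<in>UNIV. \<Sum>\<tau>\<in>UNIV. \<Sum>\<rho>\<in>UNIV. eps_low1 \<mu> \<kappa> \<nu> \<tau> * eps \<rho> \<kappa> \<nu> \<tau> * Z \<rho>)"
    unfolding tr4_eq T_def by (simp add: sum_distrib_left mult_ac)
  also have "\<dots> = (\<Sum>\<rho>\<in>UNIV. \<Sum>\<kappa>\<in>UNIV. \<Sum>\<nu>\<in>UNIV. \<Sum>\<tau>\<in>UNIV. eps_low1 \<mu> \<kappa> \<nu> \<tau> * eps \<rho> \<kappa> \<nu> \<tau> * Z \<rho>)"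
    by (subst (3) sum.swap, subst (2) sum.swap, subst sum.swap) (rule refl)
  also have "\<dots> = 6 * sg * lower1 g Z \<mu>"
    by (simp add: eps_low1_eps_contract3 lower1_def flip: sum_distrib_right) (simp add: sum_distrib_left mult_ac)
  finally show "tr g eps 4 T \<mu> = 6 * sg * lower1 g Z \<mu>" .
qed

lemma oddc_oddc_contract2:
  "oddc g eps 1 (\<lambda>x y z. oddc g eps 1 N z x y) \<nu> \<alpha> \<mu> = 2 * sg * (N \<alpha> \<mu> \<nu> - N \<mu> \<alpha> \<nu>)"
proof -
  have "oddc g eps 1 (\<lambda>x y z. oddc g eps 1 N z x y) \<nu> \<alpha> \<mu>
    = (\<Sum>\<beta>\<in>UNIV. \<Sum>\<gamma>\<in>UNIV. \<Sum>\<kappa>\<in>UNIV. \<Sum>\<tau>\<in>UNIV. N \<kappa> \<tau> \<nu> * (eps2 \<beta> \<gamma> \<alpha> \<mu> * eps2 \<kappa> \<tau> \<beta> \<gamma>))"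
    unfolding oddc_def by (simp add: sum_distrib_right) (simp add: mult_ac)
  also have "\<dots> = (\<Sum>\<kappa>\<in>UNIV. \<Sum>\<tau>\<in>UNIV. \<Sum>\<beta>\<in>UNIV. \<Sum>\<gamma>\<in>UNIV. N \<kappa> \<tau> \<nu> * (eps2 \<beta> \<gamma> \<alpha> \<mu> * eps2 \<kappa> \<tau> \<beta> \<gamma>))"
    by (subst (2) sum.swap, subst sum.swap, subst (3) sum.swap, subst (2) sum.swap) (rule refl)
  also have "\<dots> = (\<Sum>\<kappa>\<in>UNIV. \<Sum>\<tau>\<in>UNIV. 2 * sg * (N \<kappa> \<tau> \<nu> * kd \<alpha> \<kappa> * kd \<mu> \<tau> - N \<kappa> \<tau> \<nu> * kd \<alpha> \<tau> * kd \<mu> \<kappa>))"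
    by (simp add: eps2_eps2_contract2 flip: sum_distrib_left) (simp add: algebra_simps sum_distrib_left)
  also have "\<dots> = 2 * sg * (N \<alpha> \<mu> \<nu> - N \<mu> \<alpha> \<nu>)"
    by (simp add: sum_subtractf flip: sum_distrib_left sum_distrib_right)
  finally show ?thesis .
qed

text \<open>Only one index is summed between the two pseudo-tensors; the other upper index of the
  outer one meets the array itself, which is how traces 2 and 3 of N arise.\<close>

lemma oddc_oddc_contract1:
  "oddc g eps 1 (oddc g eps 1 N) \<nu> \<alpha> \<mu> =
    - sg * (N \<alpha> \<mu> \<nu> - N \<mu> \<alpha> \<nu> + (tr g eps 2 N \<alpha> - tr g eps 3 N \<alpha>) * g $ \<mu> $ \<nu>
      - (tr g eps 2 N \<mu> - tr g eps 3 N \<mu>) * g $ \<alpha> $ \<nu>)"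
proof -
  have "oddc g eps 1 (oddc g eps 1 N) \<nu> \<alpha> \<mu>
    = (\<Sum>\<beta>\<in>UNIV. \<Sum>\<gamma>\<in>UNIV. \<Sum>\<kappa>\<in>UNIV. \<Sum>\<tau>\<in>UNIV. N \<kappa> \<tau> \<beta> * (eps2 \<beta> \<gamma> \<alpha> \<mu> * eps2 \<kappa> \<tau> \<gamma> \<nu>))"
    unfolding oddc_def by (simp add: sum_distrib_right) (simp add: mult_ac)
  also have "\<dots> = (\<Sum>\<beta>\<in>UNIV. \<Sum>\<kappa>\<in>UNIV. \<Sum>\<tau>\<in>UNIV. \<Sum>\<gamma>\<in>UNIV. N \<kappa> \<tau> \<beta> * (eps2 \<beta> \<gamma> \<alpha> \<mu> * eps2 \<kappa> \<tau> \<gamma> \<nu>))"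
    by (subst (2) sum.swap, subst (3) sum.swap) (rule refl)
  also have "\<dots> = (\<Sum>\<beta>\<in>UNIV. \<Sum>\<kappa>\<in>UNIV. \<Sum>\<tau>\<in>UNIV. - sg *
       (g $ \<mu> $ \<nu> * (N \<kappa> \<tau> \<beta> * gu \<beta> \<kappa> * kd \<alpha> \<tau>) - g $ \<alpha> $ \<nu> * (N \<kappa> \<tau> \<beta> * gu \<beta> \<kappa> * kd \<mu> \<tau>)
      - g $ \<mu> $ \<nu> * (N \<kappa> \<tau> \<beta> * gu \<beta> \<tau> * kd \<alpha> \<kappa>) + g $ \<alpha> $ \<nu> * (N \<kappa> \<tau> \<beta> * gu \<beta> \<tau> * kd \<mu> \<kappa>)
      + N \<kappa> \<tau> \<beta> * kd \<alpha> \<kappa> * kd \<mu> \<tau> * kd \<beta> \<nu> - N \<kappa> \<tau> \<beta> * kd \<mu> \<kappa> * kd \<alpha> \<tau> * kd \<beta> \<nu>))"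
    by (simp add: eps2_eps2_contract1 flip: sum_distrib_left) (simp add: algebra_simps g_sym)
  also have "\<dots> = - sg * (g $ \<mu> $ \<nu> * (\<Sum>\<beta>\<in>UNIV. \<Sum>\<kappa>\<in>UNIV. N \<kappa> \<alpha> \<beta> * gu \<beta> \<kappa>)
      - g $ \<alpha> $ \<nu> * (\<Sum>\<beta>\<in>UNIV. \<Sum>\<kappa>\<in>UNIV. N \<kappa> \<mu> \<beta> * gu \<beta> \<kappa>)
      - g $ \<mu> $ \<nu> * (\<Sum>\<beta>\<in>UNIV. \<Sum>\<tau>\<in>UNIV. N \<alpha> \<tau> \<beta> * gu \<beta> \<tau>)
      + g $ \<alpha> $ \<nu> * (\<Sum>\<beta>\<in>UNIV. \<Sum>\<tau>\<in>UNIV. N \<mu> \<tau> \<beta> * gu \<beta> \<tau>)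
      + N \<alpha> \<mu> \<nu> - N \<mu> \<alpha> \<nu>)"
    by (simp only: sum.distrib sum_subtractf sum_kd flip: sum_distrib_left sum_distrib_right)
  also have "\<dots> = - sg * (g $ \<mu> $ \<nu> * tr g eps 2 N \<alpha> - g $ \<alpha> $ \<nu> * tr g eps 2 N \<mu>
      - g $ \<mu> $ \<nu> * tr g eps 3 N \<alpha> + g $ \<alpha> $ \<nu> * tr g eps 3 N \<mu> + N \<alpha> \<mu> \<nu> - N \<mu> \<alpha> \<nu>)"
    unfolding tr_def by (subst (1 2 3 4) sum.swap) (simp add: gu_sym)
  finally show ?thesis
    by (simp add: algebra_simps)
qed

text \<open>Two signs cancel: one from the upper pair of the outer pseudo-tensor, one from the last
  pair of the inner contraction.\<close>

lemma oddc_1_perm_oddc: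
  "oddc g eps 1 (\<lambda>x y z. oddc g eps 1 N y z x) \<nu> \<alpha> \<mu> = oddc g eps 1 (oddc g eps 1 N) \<nu> \<alpha> \<mu>"
proof -
  have anti: "(\<lambda>x y z. oddc g eps 1 N x z y) = (\<lambda>x y z. - 1 * oddc g eps 1 N x y z)"
    by (intro ext, subst oddc_antisym) simp
  show ?thesis
    using oddc_1_swap[of "\<lambda>x y z. oddc g eps 1 N x z y" \<nu> \<alpha> \<mu>]
    unfolding anti oddc_mult by simp
qed

lemma lower1_raise1: "lower1 g (raise1 g X) = X"
  by (intro ext) (simp add: lower1_def raise1_def lower_raise)

lemma eps_up1_raise1: "(\<Sum>\<rho>\<in>UNIV. eps_up1 g eps \<rho> \<alpha> \<mu> \<nu> * X \<rho>) = (\<Sum>\<rho>\<in>UNIV. eps \<rho> \<alpha> \<mu> \<nu> * raise1 g X \<rho>)"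
  unfolding eps_up1_def raise1_def
  by (simp add: sum_distrib_left sum_distrib_right, subst sum.swap) (simp add: gu_sym mult_ac)

lemma raise1_linear: "raise1 g (\<lambda>x. k * X x + l * Y x + m * Z x) \<mu>
    = k * raise1 g X \<mu> + l * raise1 g Y \<mu> + m * raise1 g Z \<mu>"
  by (simp add: raise1_def sum_distrib_left sum.distrib distrib_left mult_ac)

lemma oddc_1_perm:
  "oddc g eps 1 (\<lambda>x y z. N z x y) = oddc g eps 3 N"
  "oddc g eps 1 (\<lambda>x y z. N x z y) = oddc g eps 2 N"
  "oddc g eps 1 (\<lambda>x y z. N y z x) \<kappa> \<alpha> \<beta> = - oddc g eps 2 N \<kappa> \<alpha> \<beta>"
  "oddc g eps 1 (\<lambda>x y z. N z y x) \<kappa> \<alpha> \<beta> = - oddc g eps 3 N \<kappa> \<alpha> \<beta>"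
  "oddc g eps 1 (\<lambda>x y z. N y x z) \<kappa> \<alpha> \<beta> = - oddc g eps 1 N \<kappa> \<alpha> \<beta>"
  unfolding oddc_2_eq oddc_3_eq
  using oddc_1_swap[of "\<lambda>x y z. N x z y" \<kappa> \<alpha> \<beta>] oddc_1_swap[of "\<lambda>x y z. N z x y" \<kappa> \<alpha> \<beta>]
    oddc_1_swap[of N \<kappa> \<alpha> \<beta>] by simp_all

lemma tr_oddc_2:
  "tr g eps 1 (oddc g eps 2 N) \<mu> = tr g eps 4 N \<mu>"
  "tr g eps 2 (oddc g eps 2 N) \<mu> = - tr g eps 4 N \<mu>"
  "tr g eps 3 (oddc g eps 2 N) \<mu> = 0"
  "tr g eps 4 (oddc g eps 2 N) \<mu> = 2 * sg * (tr g eps 3 N \<mu> - tr g eps 1 N \<mu>)"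
  unfolding oddc_2_eq tr_oddc by (simp_all add: tr_4_swap23[of N] tr_perm[of N])

lemma tr_oddc_3:
  "tr g eps 1 (oddc g eps 3 N) \<mu> = - tr g eps 4 N \<mu>"
  "tr g eps 2 (oddc g eps 3 N) \<mu> = tr g eps 4 N \<mu>"
  "tr g eps 3 (oddc g eps 3 N) \<mu> = 0"
  "tr g eps 4 (oddc g eps 3 N) \<mu> = 2 * sg * (tr g eps 2 N \<mu> - tr g eps 1 N \<mu>)"
  unfolding oddc_3_eq tr_oddc by (simp_all add: tr_4_perm[of N] tr_perm[of N])

text \<open>The number in the name counts the index pairs summed between the two pseudo-tensors.\<close>

definition contr2 :: "tensor3 \<Rightarrow> tensor3" where
  "contr2 N \<nu> \<alpha> \<mu> = 2 * sg * (N \<alpha> \<mu> \<nu> - N \<mu> \<alpha> \<nu>)"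

definition contr1 :: "tensor3 \<Rightarrow> tensor3" where
  "contr1 N \<nu> \<alpha> \<mu> = - sg * (N \<alpha> \<mu> \<nu> - N \<mu> \<alpha> \<nu> + (tr g eps 2 N \<alpha> - tr g eps 3 N \<alpha>) * g $ \<mu> $ \<nu>
      - (tr g eps 2 N \<mu> - tr g eps 3 N \<mu>) * g $ \<alpha> $ \<nu>)"

text \<open>Up to sign there are two cases: both antisymmetric indices of the inner contraction are
  summed with the outer pseudo-tensor, or only one of them.\<close>

lemma oddc_1_perm_oddc_1:
  "oddc g eps 1 (oddc g eps 1 N) = contr1 N"
  "oddc g eps 1 (\<lambda>x y z. oddc g eps 1 N z x y) = contr2 N"
  "oddc g eps 1 (\<lambda>x y z. oddc g eps 1 N y z x) = contr1 N"
  "oddc g eps 1 (\<lambda>x y z. oddc g eps 1 N x z y) \<kappa> \<alpha> \<beta> = - contr1 N \<kappa> \<alpha> \<beta>"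
  "oddc g eps 1 (\<lambda>x y z. oddc g eps 1 N z y x) \<kappa> \<alpha> \<beta> = - contr2 N \<kappa> \<alpha> \<beta>"
  "oddc g eps 1 (\<lambda>x y z. oddc g eps 1 N y x z) \<kappa> \<alpha> \<beta> = - contr1 N \<kappa> \<alpha> \<beta>"
proof -
  show 1: "oddc g eps 1 (oddc g eps 1 N) = contr1 N"
    by (intro ext) (simp only: contr1_def oddc_oddc_contract1)
  show 2: "oddc g eps 1 (\<lambda>x y z. oddc g eps 1 N z x y) = contr2 N"
    by (intro ext) (simp only: contr2_def oddc_oddc_contract2)
  show 3: "oddc g eps 1 (\<lambda>x y z. oddc g eps 1 N y z x) = contr1 N"
    by (intro ext) (simp only: contr1_def oddc_1_perm_oddc oddc_oddc_contract1)
  show "oddc g eps 1 (\<lambda>x y z. oddc g eps 1 N x z y) \<kappa> \<alpha> \<beta> = - contr1 N \<kappa> \<alpha> \<beta>"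
    using oddc_1_swap[of "\<lambda>x y z. oddc g eps 1 N y z x" \<kappa> \<alpha> \<beta>] 3 by simp
  show "oddc g eps 1 (\<lambda>x y z. oddc g eps 1 N z y x) \<kappa> \<alpha> \<beta> = - contr2 N \<kappa> \<alpha> \<beta>"
    using oddc_1_swap[of "\<lambda>x y z. oddc g eps 1 N z x y" \<kappa> \<alpha> \<beta>] 2 by simp
  show "oddc g eps 1 (\<lambda>x y z. oddc g eps 1 N y x z) \<kappa> \<alpha> \<beta> = - contr1 N \<kappa> \<alpha> \<beta>"
    using oddc_1_swap[of "oddc g eps 1 N" \<kappa> \<alpha> \<beta>] 1 by simp
qed

end

subsection \<open>The two linear systems\<close>

locale tensor_equation = metric_frame +
  fixes a a7 a8 a9 bs c :: "nat \<Rightarrow> real" and b :: "nat \<Rightarrow> nat \<Rightarrow> real"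
begin

definition lhs :: "tensor3 \<Rightarrow> tensor3" where
  "lhs N \<alpha> \<mu> \<nu> =
        a 1 * N \<alpha> \<mu> \<nu> + a 2 * N \<nu> \<alpha> \<mu> + a 3 * N \<mu> \<nu> \<alpha>
      + a 4 * N \<alpha> \<nu> \<mu> + a 5 * N \<nu> \<mu> \<alpha> + a 6 * N \<mu> \<alpha> \<nu>
      + (\<Sum>i=1..3. a7 i * tr g eps i N \<mu> * g $ \<alpha> $ \<nu>
                  + a8 i * tr g eps i N \<nu> * g $ \<alpha> $ \<mu>
                  + a9 i * tr g eps i N \<alpha> * g $ \<mu> $ \<nu>)
      + (b 1 1 * oddc g eps 1 N \<alpha> \<mu> \<nu> + b 1 2 * oddc g eps 1 N \<nu> \<alpha> \<mu> + b 1 3 * oddc g eps 1 N \<mu> \<nu> \<alpha>)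
      + (b 2 1 * oddc g eps 2 N \<alpha> \<mu> \<nu> + b 2 2 * oddc g eps 2 N \<nu> \<alpha> \<mu> + b 2 3 * oddc g eps 2 N \<mu> \<nu> \<alpha>)
      + (b 3 1 * oddc g eps 3 N \<alpha> \<mu> \<nu> + b 3 2 * oddc g eps 3 N \<nu> \<alpha> \<mu> + b 3 3 * oddc g eps 3 N \<mu> \<nu> \<alpha>)
      + (\<Sum>\<rho>\<in>UNIV. eps \<rho> \<alpha> \<mu> \<nu> *
           (bs 1 * raise1 g (tr g eps 1 N) \<rho> + bs 2 * raise1 g (tr g eps 2 N) \<rho>
            + bs 3 * raise1 g (tr g eps 3 N) \<rho>))
      + c 1 * tr g eps 4 N \<mu> * g $ \<alpha> $ \<nu>
      + c 2 * tr g eps 4 N \<nu> * g $ \<alpha> $ \<mu>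
      + c 3 * tr g eps 4 N \<alpha> * g $ \<mu> $ \<nu>"

definition core :: "tensor3 \<Rightarrow> tensor3" where
  "core N \<alpha> \<mu> \<nu> =
        a 1 * N \<alpha> \<mu> \<nu> + a 2 * N \<nu> \<alpha> \<mu> + a 3 * N \<mu> \<nu> \<alpha>
      + a 4 * N \<alpha> \<nu> \<mu> + a 5 * N \<nu> \<mu> \<alpha> + a 6 * N \<mu> \<alpha> \<nu>
      + (b 1 1 * oddc g eps 1 N \<alpha> \<mu> \<nu> + b 1 2 * oddc g eps 1 N \<nu> \<alpha> \<mu> + b 1 3 * oddc g eps 1 N \<mu> \<nu> \<alpha>)
      + (b 2 1 * oddc g eps 2 N \<alpha> \<mu> \<nu> + b 2 2 * oddc g eps 2 N \<nu> \<alpha> \<mu> + b 2 3 * oddc g eps 2 N \<mu> \<nu> \<alpha>)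
      + (b 3 1 * oddc g eps 3 N \<alpha> \<mu> \<nu> + b 3 2 * oddc g eps 3 N \<nu> \<alpha> \<mu> + b 3 3 * oddc g eps 3 N \<mu> \<nu> \<alpha>)"

definition trace_part :: "(nat \<Rightarrow> real) \<Rightarrow> real \<Rightarrow> tensor3 \<Rightarrow> tensor1" where
  "trace_part f d N \<mu> = (\<Sum>i=1..3. f i * tr g eps i N \<mu>) + d * tr g eps 4 N \<mu>"

definition eps_part :: "tensor3 \<Rightarrow> tensor1" where
  "eps_part N \<rho> = bs 1 * tr g eps 1 N \<rho> + bs 2 * tr g eps 2 N \<rho> + bs 3 * tr g eps 3 N \<rho>"

text \<open>Collects the trace terms into single vectors, in the shapes to which
  \<open>tr_eps\<close> and \<open>tr_metric\<close> apply.\<close>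

lemma lhs_eq:
  "lhs N = (\<lambda>\<alpha> \<mu> \<nu>. core N \<alpha> \<mu> \<nu> + (\<Sum>\<rho>\<in>UNIV. eps \<rho> \<alpha> \<mu> \<nu> * raise1 g (eps_part N) \<rho>)
     + trace_part a7 (c 1) N \<mu> * g $ \<alpha> $ \<nu> + trace_part a8 (c 2) N \<nu> * g $ \<alpha> $ \<mu>
     + trace_part a9 (c 3) N \<alpha> * g $ \<mu> $ \<nu>)"
proof -
  have "raise1 g (eps_part N) \<rho> = bs 1 * raise1 g (tr g eps 1 N) \<rho> + bs 2 * raise1 g (tr g eps 2 N) \<rho>
            + bs 3 * raise1 g (tr g eps 3 N) \<rho>" for \<rho>
    unfolding eps_part_def[abs_def] raise1_linear ..
  then show ?thesis
    unfolding lhs_def[abs_def] core_def trace_part_def sum_1_to_3 by (simp add: algebra_simps)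
qed

lemma Gmat_mult_traces:
  fixes N \<mu>
  defines "t \<equiv> \<lambda>i. tr g eps i N \<mu>"
  shows "Gmat s a a7 a8 a9 b bs c *v vector [t 1, t 2, t 3, t 4]
    = vector [tr g eps 1 (lhs N) \<mu>, tr g eps 2 (lhs N) \<mu>, tr g eps 3 (lhs N) \<mu>, tr g eps 4 (lhs N) \<mu>]"
proof -
  have lower_part: "lower1 g (raise1 g (eps_part N)) \<mu> = bs 1 * t 1 + bs 2 * t 2 + bs 3 * t 3"
    by (simp add: lower1_raise1 eps_part_def t_def)
  \<comment> \<open>The permutation rules are instantiated at N and its three contractions; with a
    variable array some of them would match their own results.\<close>
  note expand = lhs_eq core_def[abs_def] tr_add tr_mult tr_metric tr_eps tr_perm[of N] tr_4_perm[of N]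
    tr_4_swap12[of N] tr_4_swap23[of N]
    tr_perm[of "oddc g eps 1 N"] tr_4_perm[of "oddc g eps 1 N"]
    tr_perm[of "oddc g eps 2 N"] tr_4_perm[of "oddc g eps 2 N"]
    tr_perm[of "oddc g eps 3 N"] tr_4_perm[of "oddc g eps 3 N"] tr_oddc tr_oddc_2 tr_oddc_3
    lower_part trace_part_def sum_1_to_3
  have "tr g eps i (lhs N) \<mu> = Gmat s a a7 a8 a9 b bs c $ of_nat i $ 1 * t 1
    + Gmat s a a7 a8 a9 b bs c $ of_nat i $ 2 * t 2 + Gmat s a a7 a8 a9 b bs c $ of_nat i $ 3 * t 3
    + Gmat s a a7 a8 a9 b bs c $ of_nat i $ 4 * t 4" if "i \<in> {1, 2, 3, 4}" for i
    using that
  proof (elim insertE emptyE)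
    assume "i = 1"
    show ?thesis
      unfolding \<open>i = 1\<close> expand t_def by (simp add: Gmat_def vector_def algebra_simps)
  next
    assume "i = 2"
    show ?thesis
      unfolding \<open>i = 2\<close> expand t_def by (simp add: Gmat_def vector_def algebra_simps)
  next
    assume "i = 3"
    show ?thesis
      unfolding \<open>i = 3\<close> expand t_def by (simp add: Gmat_def vector_def algebra_simps)
  next
    assume "i = 4"
    show ?thesis
      unfolding \<open>i = 4\<close> expand t_def by (simp add: Gmat_def vector_def algebra_simps)
  qed
  from this[of 1] this[of 2] this[of 3] this[of 4] show ?thesis
    unfolding vec_eq_iff forall_4 by (simp add: matrix_vector_mult_def sum_4) (simp add: vector_def)
qed


section \<open>Contractions of the equation freed from traces\<close>

text \<open>\<open>B_breve\<close> expressed through the unknown: traces of N replace the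
  combinations of traces of B. The added terms are chosen to cancel the metric terms of
  \<open>contr1\<close>; likewise for \<open>bar_of\<close> and \<open>ring_of\<close>.\<close>

definition breve_of :: "tensor3 \<Rightarrow> tensor3" where
  "breve_of N \<alpha> \<mu> \<nu> = oddc g eps 1 (core N) \<nu> \<alpha> \<mu> + 2 * sg *
    ((b 2 1 + b 2 3 + b 3 1 + b 3 3) * antisym_g g (tr g eps 1 N) \<alpha> \<mu> \<nu>
   + (b 1 1 + b 1 3 - b 3 1 - b 3 3) * antisym_g g (tr g eps 2 N) \<alpha> \<mu> \<nu>
   - (b 1 1 + b 1 3 + b 2 1 + b 2 3) * antisym_g g (tr g eps 3 N) \<alpha> \<mu> \<nu>)"

definition bar_of :: "tensor3 \<Rightarrow> tensor3" where
  "bar_of N \<alpha> \<mu> \<nu> = oddc g eps 2 (core N) \<mu> \<alpha> \<nu> - 2 * sg *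
    ((b 2 1 + b 2 2 + b 3 1 + b 3 2) * antisym_g g (tr g eps 1 N) \<alpha> \<nu> \<mu>
   + (b 1 1 + b 1 2 - b 3 1 - b 3 2) * antisym_g g (tr g eps 2 N) \<alpha> \<nu> \<mu>
   - (b 1 1 + b 1 2 + b 2 1 + b 2 2) * antisym_g g (tr g eps 3 N) \<alpha> \<nu> \<mu>)"

definition ring_of :: "tensor3 \<Rightarrow> tensor3" where
  "ring_of N \<alpha> \<mu> \<nu> = oddc g eps 3 (core N) \<alpha> \<mu> \<nu> - 2 * (-1) ^ (s + 1) *
    ((b 2 2 + b 2 3 + b 3 2 + b 3 3) * antisym_g g (tr g eps 1 N) \<mu> \<nu> \<alpha>
   + (b 1 2 + b 1 3 - b 3 2 - b 3 3) * antisym_g g (tr g eps 2 N) \<mu> \<nu> \<alpha>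
   - (b 2 2 + b 2 3 + b 1 2 + b 1 3) * antisym_g g (tr g eps 3 N) \<mu> \<nu> \<alpha>)"

lemma oddc_1_perm_oddc_23:
  "oddc g eps 1 (oddc g eps 2 N) = contr1 (\<lambda>x y z. N x z y)"
  "oddc g eps 1 (\<lambda>x y z. oddc g eps 2 N z x y) = contr2 (\<lambda>x y z. N x z y)"
  "oddc g eps 1 (\<lambda>x y z. oddc g eps 2 N y z x) = contr1 (\<lambda>x y z. N x z y)"
  "oddc g eps 1 (\<lambda>x y z. oddc g eps 2 N x z y) \<kappa> \<alpha> \<beta> = - contr1 (\<lambda>x y z. N x z y) \<kappa> \<alpha> \<beta>"
  "oddc g eps 1 (\<lambda>x y z. oddc g eps 2 N z y x) \<kappa> \<alpha> \<beta> = - contr2 (\<lambda>x y z. N x z y) \<kappa> \<alpha> \<beta>"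
  "oddc g eps 1 (\<lambda>x y z. oddc g eps 2 N y x z) \<kappa> \<alpha> \<beta> = - contr1 (\<lambda>x y z. N x z y) \<kappa> \<alpha> \<beta>"
  "oddc g eps 1 (oddc g eps 3 N) = contr1 (\<lambda>x y z. N z x y)"
  "oddc g eps 1 (\<lambda>x y z. oddc g eps 3 N z x y) = contr2 (\<lambda>x y z. N z x y)"
  "oddc g eps 1 (\<lambda>x y z. oddc g eps 3 N y z x) = contr1 (\<lambda>x y z. N z x y)"
  "oddc g eps 1 (\<lambda>x y z. oddc g eps 3 N x z y) \<kappa> \<alpha> \<beta> = - contr1 (\<lambda>x y z. N z x y) \<kappa> \<alpha> \<beta>"
  "oddc g eps 1 (\<lambda>x y z. oddc g eps 3 N z y x) \<kappa> \<alpha> \<beta> = - contr2 (\<lambda>x y z. N z x y) \<kappa> \<alpha> \<beta>"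
  "oddc g eps 1 (\<lambda>x y z. oddc g eps 3 N y x z) \<kappa> \<alpha> \<beta> = - contr1 (\<lambda>x y z. N z x y) \<kappa> \<alpha> \<beta>"
  by (simp_all only: oddc_2_eq[of g eps N] oddc_3_eq[of g eps N] oddc_1_perm_oddc_1)

text \<open>The weight 2 belongs to the one arrangement giving \<open>contr2\<close>, the weights -1
  to the two giving \<open>contr1\<close>. Differences such as \<open>a 1 - a 6\<close> arise
  because arrays differing by a swap of the contracted slots contribute with opposite signs.\<close>

lemma breve_of_eq:
  "breve_of N \<alpha> \<mu> \<nu> = sg *
      ((2 * b 1 2 - b 1 1 - b 1 3) * (N \<alpha> \<mu> \<nu> - N \<mu> \<alpha> \<nu>)
     + (2 * b 2 2 - b 2 1 - b 2 3) * (N \<alpha> \<nu> \<mu> - N \<mu> \<nu> \<alpha>)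
     + (2 * b 3 2 - b 3 1 - b 3 3) * (N \<nu> \<alpha> \<mu> - N \<nu> \<mu> \<alpha>))
    + (a 1 - a 6) * oddc g eps 1 N \<nu> \<alpha> \<mu> + (a 4 - a 3) * oddc g eps 2 N \<nu> \<alpha> \<mu>
    + (a 2 - a 5) * oddc g eps 3 N \<nu> \<alpha> \<mu>"
  unfolding breve_of_def core_def[abs_def] oddc_add oddc_mult
    oddc_1_perm[of N] oddc_1_perm_oddc_1[of N] oddc_1_perm_oddc_23 contr1_def contr2_def antisym_g_def tr_perm[of N]
  by (simp add: algebra_simps add_divide_distrib diff_divide_distrib)

lemma bar_of_eq:
  "bar_of N \<alpha> \<mu> \<nu> = sg *
      ((b 1 1 + b 1 2 - 2 * b 1 3) * (N \<alpha> \<nu> \<mu> - N \<nu> \<alpha> \<mu>)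
     + (b 2 1 + b 2 2 - 2 * b 2 3) * (N \<alpha> \<mu> \<nu> - N \<nu> \<mu> \<alpha>)
     + (b 3 1 + b 3 2 - 2 * b 3 3) * (N \<mu> \<alpha> \<nu> - N \<mu> \<nu> \<alpha>))
    + (a 4 - a 2) * oddc g eps 1 N \<mu> \<alpha> \<nu> + (a 1 - a 5) * oddc g eps 2 N \<mu> \<alpha> \<nu>
    + (a 6 - a 3) * oddc g eps 3 N \<mu> \<alpha> \<nu>"
  \<comment> \<open>The sum pattern restricts the rewriting to the contraction of the core;
    \<open>oddc g eps 2 N\<close> itself must remain, being one of the unknowns.\<close>
  unfolding bar_of_def core_def[abs_def] oddc_2_eq[of g eps "\<lambda>x y z. _ x y z + _ x y z"] oddc_add oddc_mult
    oddc_1_perm[of N] oddc_1_perm_oddc_1[of N] oddc_1_perm_oddc_23 contr1_def contr2_def antisym_g_def tr_perm[of N]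
  by (simp add: algebra_simps add_divide_distrib diff_divide_distrib)

lemma ring_of_eq:
  "ring_of N \<alpha> \<mu> \<nu> = sg *
      ((2 * b 1 1 - b 1 2 - b 1 3) * (N \<mu> \<nu> \<alpha> - N \<nu> \<mu> \<alpha>)
     + (2 * b 2 1 - b 2 2 - b 2 3) * (N \<mu> \<alpha> \<nu> - N \<nu> \<alpha> \<mu>)
     + (2 * b 3 1 - b 3 2 - b 3 3) * (N \<alpha> \<mu> \<nu> - N \<alpha> \<nu> \<mu>))
    + (a 3 - a 5) * oddc g eps 1 N \<alpha> \<mu> \<nu> + (a 6 - a 2) * oddc g eps 2 N \<alpha> \<mu> \<nu>
    + (a 1 - a 4) * oddc g eps 3 N \<alpha> \<mu> \<nu>"
  unfolding ring_of_def core_def[abs_def] oddc_3_eq[of g eps "\<lambda>x y z. _ x y z + _ x y z"] oddc_add oddc_mult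
    oddc_1_perm[of N] oddc_1_perm_oddc_1[of N] oddc_1_perm_oddc_23 contr1_def contr2_def antisym_g_def tr_perm[of N]
  by (simp add: algebra_simps add_divide_distrib diff_divide_distrib)


section \<open>The system for the permutations of the unknown and of its contractions\<close>

definition unknowns :: "tensor3 \<Rightarrow> 4 \<Rightarrow> 4 \<Rightarrow> 4 \<Rightarrow> real^15" where
  "unknowns N \<alpha> \<mu> \<nu> = vector
     [N \<alpha> \<mu> \<nu>, N \<nu> \<alpha> \<mu>, N \<mu> \<nu> \<alpha>, N \<alpha> \<nu> \<mu>, N \<nu> \<mu> \<alpha>, N \<mu> \<alpha> \<nu>,
      oddc g eps 1 N \<alpha> \<mu> \<nu>, oddc g eps 1 N \<nu> \<alpha> \<mu>, oddc g eps 1 N \<mu> \<nu> \<alpha>,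
      oddc g eps 2 N \<alpha> \<mu> \<nu>, oddc g eps 2 N \<nu> \<alpha> \<mu>, oddc g eps 2 N \<mu> \<nu> \<alpha>,
      oddc g eps 3 N \<alpha> \<mu> \<nu>, oddc g eps 3 N \<nu> \<alpha> \<mu>, oddc g eps 3 N \<mu> \<nu> \<alpha>]"

text \<open>The last nine rows list the arrangements as \<alpha>\<mu>\<nu>, \<mu>\<nu>\<alpha>,
  \<nu>\<alpha>\<mu>, whereas the columns use \<alpha>\<mu>\<nu>, \<nu>\<alpha>\<mu>,
  \<mu>\<nu>\<alpha>. The solution formula inherits both orders.\<close>

lemma Amat_mult_unknowns:
  "Amat s a b *v unknowns N \<alpha> \<mu> \<nu> = vector
     [core N \<alpha> \<mu> \<nu>, core N \<nu> \<alpha> \<mu>, core N \<mu> \<nu> \<alpha>, core N \<alpha> \<nu> \<mu>, core N \<nu> \<mu> \<alpha>, core N \<mu> \<alpha> \<nu>,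
      breve_of N \<alpha> \<mu> \<nu>, breve_of N \<mu> \<nu> \<alpha>, breve_of N \<nu> \<alpha> \<mu>,
      bar_of N \<alpha> \<mu> \<nu>, bar_of N \<mu> \<nu> \<alpha>, bar_of N \<nu> \<alpha> \<mu>,
      ring_of N \<alpha> \<mu> \<nu>, ring_of N \<mu> \<nu> \<alpha>, ring_of N \<nu> \<alpha> \<mu>]" (is "_ = ?r")
proof -
  \<comment> \<open>Odd arrangements of the contractions have no column of their own and are folded
    into the three even ones.\<close>
  have anti: "oddc g eps i N \<alpha> \<nu> \<mu> = - oddc g eps i N \<alpha> \<mu> \<nu>"
    "oddc g eps i N \<nu> \<mu> \<alpha> = - oddc g eps i N \<nu> \<alpha> \<mu>"
    "oddc g eps i N \<mu> \<alpha> \<nu> = - oddc g eps i N \<mu> \<nu> \<alpha>" for i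
    by (rule oddc_antisym)+
  have "(Amat s a b *v unknowns N \<alpha> \<mu> \<nu>) $ i = ?r $ i" for i
  proof -
    have row: "(Amat s a b *v unknowns N \<alpha> \<mu> \<nu>) $ i = (\<Sum>j\<in>UNIV. Amat s a b $ i $ j * unknowns N \<alpha> \<mu> \<nu> $ j)"
      by (simp add: matrix_vector_mult_def)
    note unf = core_def breve_of_eq bar_of_eq ring_of_eq anti
    show ?thesis
      unfolding row
      using exhaust_15[of i] unfolding unknowns_def
      by (elim insertE emptyE; simp only: unf; simp only: Amat_def Let_def vector_15 list.map row15_mult_vector; simp add: algebra_simps)
  qed
  then show ?thesis
    by (simp add: vec_eq_iff)
qed


section \<open>Recovering the unknown from the right-hand side\<close>

lemma traces_of_solution:
  assumes "det (Gmat s a a7 a8 a9 b bs c) \<noteq> 0" "lhs N = B" "i \<in> {1..4}"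
  shows "(\<Sum>j=1..4. matrix_inv (Gmat s a a7 a8 a9 b bs c) $ of_nat i $ of_nat j * tr g eps j B \<mu>) = tr g eps i N \<mu>"
proof -
  let ?G = "Gmat s a a7 a8 a9 b bs c"
  let ?v = "\<lambda>N. vector [tr g eps 1 N \<mu>, tr g eps 2 N \<mu>, tr g eps 3 N \<mu>, tr g eps 4 N \<mu>] :: real^4"
  have v: "?v N $ of_nat i = tr g eps i N \<mu>" if "i \<in> {1..4}" for i N
  proof -
    have "i = 1 \<or> i = 2 \<or> i = 3 \<or> i = 4" using that by auto
    then show ?thesis by (elim disjE) (simp_all add: vector_def)
  qed
  have "matrix_inv ?G *v ?v B = (matrix_inv ?G ** ?G) *v ?v N"
    using Gmat_mult_traces[of N \<mu>] assms(2) by (simp flip: matrix_vector_mul_assoc)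
  also have "\<dots> = ?v N"
    using matrix_inv_left_right[of ?G] assms(1) by (simp add: invertible_det_nz)
  finally have "(matrix_inv ?G *v ?v B) $ of_nat i = ?v N $ of_nat i" by simp
  then show ?thesis
    unfolding v[OF assms(3)] sum_1_to_4 by (simp add: matrix_vector_mult_def sum_4 vector_def)
qed

text \<open>The combinations of traces of B subtracted in \<open>B_hat\<close> are the traces of N,
  so exactly the trace terms of the equation are removed.\<close>

lemma B_hat_eq_core:
  assumes det: "det (Gmat s a a7 a8 a9 b bs c) \<noteq> 0" and B: "lhs N = B"
  shows "B_hat g eps (matrix_inv (Gmat s a a7 a8 a9 b bs c)) a7 a8 a9 bs c B = core N"
proof (intro ext)
  fix \<alpha> \<mu> \<nu>
  let ?\<gamma> = "\<lambda>i j. matrix_inv (Gmat s a a7 a8 a9 b bs c) $ of_nat i $ of_nat j"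
  note t = traces_of_solution[OF det B]
  have factor: "(\<Sum>j=1..4. k i * ?\<gamma> i j * tr g eps j B \<rho> * x) = k i * tr g eps i N \<rho> * x"
    if "i \<in> {1..4}" for k :: "nat \<Rightarrow> real" and i x \<rho>
    using t[OF that, of \<rho>, symmetric] by (simp add: sum_distrib_left sum_distrib_right mult_ac)
  have factor': "(\<Sum>j=1..4. k i * ?\<gamma> i j * tr g eps j B \<rho>) = k i * tr g eps i N \<rho>"
    if "i \<in> {1..4}" for k :: "nat \<Rightarrow> real" and i \<rho>
    using factor[OF that, of k \<rho> 1] by simp
  have "(\<Sum>\<rho>\<in>UNIV. eps_up1 g eps \<rho> \<alpha> \<mu> \<nu> * (\<Sum>i=1..3. \<Sum>j=1..4. bs i * ?\<gamma> i j * tr g eps j B \<rho>))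
      = (\<Sum>\<rho>\<in>UNIV. eps \<rho> \<alpha> \<mu> \<nu> * raise1 g (eps_part N) \<rho>)"
  proof -
    have "(\<Sum>i=1..3. \<Sum>j=1..4. bs i * ?\<gamma> i j * tr g eps j B \<rho>) = eps_part N \<rho>" for \<rho>
      unfolding sum_1_to_3 eps_part_def
      using factor'[where i = 1 and k = bs] factor'[where i = 2 and k = bs] factor'[where i = 3 and k = bs]
      by simp
    then show ?thesis by (simp only: eps_up1_raise1)
  qed
  \<comment> \<open>The update at 4 makes \<open>c\<close> the coefficient of the fourth trace,
    which \<open>trace_part\<close> keeps as a separate summand.\<close>
  moreover have "(\<Sum>i=1..4. \<Sum>j=1..4.
             (a7(4 := c 1)) i * ?\<gamma> i j * tr g eps j B \<mu> * g $ \<alpha> $ \<nu>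
           + (a8(4 := c 2)) i * ?\<gamma> i j * tr g eps j B \<nu> * g $ \<alpha> $ \<mu>
           + (a9(4 := c 3)) i * ?\<gamma> i j * tr g eps j B \<alpha> * g $ \<mu> $ \<nu>)
      = trace_part a7 (c 1) N \<mu> * g $ \<alpha> $ \<nu> + trace_part a8 (c 2) N \<nu> * g $ \<alpha> $ \<mu>
     + trace_part a9 (c 3) N \<alpha> * g $ \<mu> $ \<nu>"
    by (simp only: sum.distrib factor cong: sum.cong)
      (unfold trace_part_def sum_1_to_4 sum_1_to_3, simp add: algebra_simps)
  ultimately show "B_hat g eps (matrix_inv (Gmat s a a7 a8 a9 b bs c)) a7 a8 a9 bs c B \<alpha> \<mu> \<nu> = core N \<alpha> \<mu> \<nu>"
    unfolding B_hat_def Let_def using B[symmetric] by (simp add: lhs_eq)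
qed

text \<open>Again the first three rows of the inverse of \<open>Gmat\<close> turn traces of B into
  traces of N.\<close>

lemma corrected_contractions:
  fixes N
  defines "gi \<equiv> matrix_inv (Gmat s a a7 a8 a9 b bs c)"
  assumes det: "det (Gmat s a a7 a8 a9 b bs c) \<noteq> 0" and B: "lhs N = B"
  shows "B_breve s g eps gi b (core N) B = breve_of N"
    "B_bar s g eps gi b (core N) B = bar_of N"
    "B_ring s g eps gi b (core N) B = ring_of N"
proof -
  have t: "tr g eps i N = (\<lambda>\<mu>. \<Sum>j=1..4. gi $ of_nat i $ of_nat j * tr g eps j B \<mu>)" if "i \<in> {1..4}" for i
    unfolding gi_def by (intro ext) (rule traces_of_solution[OF det B that, symmetric])
  have corr: "(\<Sum>j=1..4. (k * gi $ of_nat 1 $ of_nat j + l * gi $ of_nat 2 $ of_nat j - m * gi $ of_nat 3 $ of_nat j)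
        * antisym_g g (tr g eps j B) \<alpha> \<mu> \<nu>)
      = k * antisym_g g (tr g eps 1 N) \<alpha> \<mu> \<nu> + l * antisym_g g (tr g eps 2 N) \<alpha> \<mu> \<nu>
        - m * antisym_g g (tr g eps 3 N) \<alpha> \<mu> \<nu>" for k l m \<alpha> \<mu> \<nu>
    using t[of 1] t[of 2] t[of 3] unfolding sum_1_to_4 antisym_g_def
    by (simp add: algebra_simps add_divide_distrib diff_divide_distrib)
  show "B_breve s g eps gi b (core N) B = breve_of N"
    "B_bar s g eps gi b (core N) B = bar_of N"
    "B_ring s g eps gi b (core N) B = ring_of N"
    unfolding B_breve_def[abs_def] B_bar_def[abs_def] B_ring_def[abs_def] Let_def corr
      breve_of_def[abs_def] bar_of_def[abs_def] ring_of_def[abs_def]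
    by (simp_all add: oddc_def mult.commute)
qed

section \<open>Linearity of the equation and existence of a solution\<close>

lemma lhs_add: "lhs (\<lambda>x y z. X x y z + Y x y z) \<alpha> \<mu> \<nu> = lhs X \<alpha> \<mu> \<nu> + lhs Y \<alpha> \<mu> \<nu>"
  by (simp add: lhs_def tr_add oddc_add raise1_def sum_1_to_3 distrib_left sum.distrib algebra_simps)

lemma lhs_mult: "lhs (\<lambda>x y z. k * X x y z) \<alpha> \<mu> \<nu> = k * lhs X \<alpha> \<mu> \<nu>"
  by (simp add: lhs_def tr_mult oddc_mult raise1_def sum_1_to_3 sum_distrib_left algebra_simps)


lemma lhs_solution:
  fixes N B :: tensor3
  defines "gi \<equiv> matrix_inv (Gmat s a a7 a8 a9 b bs c)"
  defines "Bh \<equiv> B_hat g eps gi a7 a8 a9 bs c B"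
  defines "Bv \<equiv> B_breve s g eps gi b Bh B" and "Bb \<equiv> B_bar s g eps gi b Bh B"
    and "Br \<equiv> B_ring s g eps gi b Bh B"
  assumes det_A: "det (Amat s a b) \<noteq> 0" and det_G: "det (Gmat s a a7 a8 a9 b bs c) \<noteq> 0"
    and B: "lhs N = B"
  shows "N \<alpha> \<mu> \<nu> = (matrix_inv (Amat s a b) *v vector
     [Bh \<alpha> \<mu> \<nu>, Bh \<nu> \<alpha> \<mu>, Bh \<mu> \<nu> \<alpha>, Bh \<alpha> \<nu> \<mu>, Bh \<nu> \<mu> \<alpha>, Bh \<mu> \<alpha> \<nu>,
      Bv \<alpha> \<mu> \<nu>, Bv \<mu> \<nu> \<alpha>, Bv \<nu> \<alpha> \<mu>, Bb \<alpha> \<mu> \<nu>, Bb \<mu> \<nu> \<alpha>, Bb \<nu> \<alpha> \<mu>,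
      Br \<alpha> \<mu> \<nu>, Br \<mu> \<nu> \<alpha>, Br \<nu> \<alpha> \<mu>]) $ 1"
proof -
  have Bh: "Bh = core N"
    unfolding Bh_def gi_def by (rule B_hat_eq_core[OF det_G B])
  have "matrix_inv (Amat s a b) *v (Amat s a b *v unknowns N \<alpha> \<mu> \<nu>) = unknowns N \<alpha> \<mu> \<nu>"
    using matrix_inv_left_right[of "Amat s a b"] det_A
    by (simp add: matrix_vector_mul_assoc invertible_det_nz)
  \<comment> \<open>Only the first component is kept: the other fourteen merely repeat permutations
    and contractions of N.\<close>
  then have "N \<alpha> \<mu> \<nu> = (matrix_inv (Amat s a b) *v (Amat s a b *v unknowns N \<alpha> \<mu> \<nu>)) $ 1"
    by (simp only: unknowns_def vector_15)
  then show ?thesis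
    unfolding Bv_def Bb_def Br_def Bh gi_def corrected_contractions[OF det_G B] Amat_mult_unknowns .
qed

text \<open>An injective endomorphism of a space of finite dimension is surjective, so the formula for
  the solutions already yields their existence.\<close>

lemma lhs_surj:
  assumes "det (Amat s a b) \<noteq> 0" "det (Gmat s a a7 a8 a9 b bs c) \<noteq> 0"
  obtains N where "lhs N = B"
proof -
  \<comment> \<open>Arrays are repackaged as vectors, so that the dimension argument applies to the
    left-hand side as a linear endomorphism.\<close>
  define f :: "real^4^4^4 \<Rightarrow> real^4^4^4" where
    "f V = (\<chi> \<alpha> \<mu> \<nu>. lhs (\<lambda>x y z. V $ x $ y $ z) \<alpha> \<mu> \<nu>)" for V
  have "linear f"
    by (rule linearI) (simp_all add: f_def vec_eq_iff lhs_add lhs_mult)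
  moreover have "inj f"
  proof (rule injI)
    fix V W
    assume "f V = f W"
    then have "lhs (\<lambda>x y z. V $ x $ y $ z) = lhs (\<lambda>x y z. W $ x $ y $ z)"
      by (simp add: f_def vec_eq_iff fun_eq_iff)
    \<comment> \<open>The right-hand side of \<open>lhs_solution\<close> depends on the array only
      through its image under \<open>lhs\<close>.\<close>
    then have "V $ \<alpha> $ \<mu> $ \<nu> = W $ \<alpha> $ \<mu> $ \<nu>" for \<alpha> \<mu> \<nu>
      using lhs_solution[OF assms, of "\<lambda>x y z. V $ x $ y $ z" _ \<alpha> \<mu> \<nu>]
        lhs_solution[OF assms, of "\<lambda>x y z. W $ x $ y $ z" _ \<alpha> \<mu> \<nu>] by metis
    then show "V = W"
      by (simp add: vec_eq_iff)
  qed
  ultimately have "surj f"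
    by (rule linear_injective_imp_surjective) simp
  then obtain V where "f V = (\<chi> \<alpha> \<mu> \<nu>. B \<alpha> \<mu> \<nu>)"
    by (metis surjD)
  then have "lhs (\<lambda>x y z. V $ x $ y $ z) = B"
    by (simp add: f_def vec_eq_iff fun_eq_iff)
  then show thesis by (rule that)
qed

end


theorem theorem1:
  fixes g :: "real^4^4" and s :: nat and eps :: tensor4
    and a a7 a8 a9 bs c :: "nat \<Rightarrow> real" and b :: "nat \<Rightarrow> nat \<Rightarrow> real"
    and Ai :: "nat \<Rightarrow> real" and gi :: "real^4^4"
    and B N Bh Bv Bb Br :: tensor3
  assumes metric: "metric_of_signature g s"
    and eps: "levi_civita g s eps"
    and det_A: "det (Amat s a b) \<noteq> 0"
    and det_Gamma: "det (Gmat s a a7 a8 a9 b bs c) \<noteq> 0"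
    and Ai: "\<And>k. Ai k = matrix_inv (Amat s a b) $ 1 $ of_nat k"
    and gi: "gi = matrix_inv (Gmat s a a7 a8 a9 b bs c)"
    and Bh: "Bh = B_hat g eps gi a7 a8 a9 bs c B"
    and Bv: "Bv = B_breve s g eps gi b Bh B"
    and Bb: "Bb = B_bar s g eps gi b Bh B"
    and Br: "Br = B_ring s g eps gi b Bh B"
  shows
    "(\<forall>\<alpha> \<mu> \<nu>.
        a 1 * N \<alpha> \<mu> \<nu> + a 2 * N \<nu> \<alpha> \<mu> + a 3 * N \<mu> \<nu> \<alpha>
      + a 4 * N \<alpha> \<nu> \<mu> + a 5 * N \<nu> \<mu> \<alpha> + a 6 * N \<mu> \<alpha> \<nu>
      + (\<Sum>i=1..3. a7 i * tr g eps i N \<mu> * g $ \<alpha> $ \<nu>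
                  + a8 i * tr g eps i N \<nu> * g $ \<alpha> $ \<mu>
                  + a9 i * tr g eps i N \<alpha> * g $ \<mu> $ \<nu>)
      + (b 1 1 * oddc g eps 1 N \<alpha> \<mu> \<nu> + b 1 2 * oddc g eps 1 N \<nu> \<alpha> \<mu> + b 1 3 * oddc g eps 1 N \<mu> \<nu> \<alpha>)
      + (b 2 1 * oddc g eps 2 N \<alpha> \<mu> \<nu> + b 2 2 * oddc g eps 2 N \<nu> \<alpha> \<mu> + b 2 3 * oddc g eps 2 N \<mu> \<nu> \<alpha>)
      + (b 3 1 * oddc g eps 3 N \<alpha> \<mu> \<nu> + b 3 2 * oddc g eps 3 N \<nu> \<alpha> \<mu> + b 3 3 * oddc g eps 3 N \<mu> \<nu> \<alpha>)
      + (\<Sum>\<rho>\<in>UNIV. eps \<rho> \<alpha> \<mu> \<nu> *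
           (bs 1 * raise1 g (tr g eps 1 N) \<rho> + bs 2 * raise1 g (tr g eps 2 N) \<rho>
            + bs 3 * raise1 g (tr g eps 3 N) \<rho>))
      + c 1 * tr g eps 4 N \<mu> * g $ \<alpha> $ \<nu>
      + c 2 * tr g eps 4 N \<nu> * g $ \<alpha> $ \<mu>
      + c 3 * tr g eps 4 N \<alpha> * g $ \<mu> $ \<nu>
      = B \<alpha> \<mu> \<nu>)
     \<longleftrightarrow>
     (\<forall>\<alpha> \<mu> \<nu>. N \<alpha> \<mu> \<nu> =
        Ai 1 * Bh \<alpha> \<mu> \<nu> + Ai 2 * Bh \<nu> \<alpha> \<mu> + Ai 3 * Bh \<mu> \<nu> \<alpha>
      + Ai 4 * Bh \<alpha> \<nu> \<mu> + Ai 5 * Bh \<nu> \<mu> \<alpha> + Ai 6 * Bh \<mu> \<alpha> \<nu>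
      + Ai 7 * Bv \<alpha> \<mu> \<nu> + Ai 8 * Bv \<mu> \<nu> \<alpha> + Ai 9 * Bv \<nu> \<alpha> \<mu>
      + Ai 10 * Bb \<alpha> \<mu> \<nu> + Ai 11 * Bb \<mu> \<nu> \<alpha> + Ai 12 * Bb \<nu> \<alpha> \<mu>
      + Ai 13 * Br \<alpha> \<mu> \<nu> + Ai 14 * Br \<mu> \<nu> \<alpha> + Ai 15 * Br \<nu> \<alpha> \<mu>)"
proof -
  interpret tensor_equation g s eps a a7 a8 a9 bs c b
    using metric eps by unfold_locales
  define S where "S = (\<lambda>\<alpha> \<mu> \<nu>.
        Ai 1 * Bh \<alpha> \<mu> \<nu> + Ai 2 * Bh \<nu> \<alpha> \<mu> + Ai 3 * Bh \<mu> \<nu> \<alpha>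
      + Ai 4 * Bh \<alpha> \<nu> \<mu> + Ai 5 * Bh \<nu> \<mu> \<alpha> + Ai 6 * Bh \<mu> \<alpha> \<nu>
      + Ai 7 * Bv \<alpha> \<mu> \<nu> + Ai 8 * Bv \<mu> \<nu> \<alpha> + Ai 9 * Bv \<nu> \<alpha> \<mu>
      + Ai 10 * Bb \<alpha> \<mu> \<nu> + Ai 11 * Bb \<mu> \<nu> \<alpha> + Ai 12 * Bb \<nu> \<alpha> \<mu>
      + Ai 13 * Br \<alpha> \<mu> \<nu> + Ai 14 * Br \<mu> \<nu> \<alpha> + Ai 15 * Br \<nu> \<alpha> \<mu>)"
  have solution: "M = S" if "lhs M = B" for M
  proof (intro ext)
    fix \<alpha> \<mu> \<nu>
    show "M \<alpha> \<mu> \<nu> = S \<alpha> \<mu> \<nu>"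
      unfolding lhs_solution[OF det_A det_Gamma that, of \<alpha> \<mu> \<nu>] S_def Br Bb Bv Bh gi Ai
      by (simp add: matrix_vector_mult_def sum_15 vector_15)
  qed
  obtain M where M: "lhs M = B"
    using lhs_surj[OF det_A det_Gamma] .
  \<comment> \<open>That S solves the equation needs no substitution: some M does, and
    \<open>solution\<close> identifies M with S.\<close>
  have "lhs N = B \<longleftrightarrow> N = S"
    using solution M by metis
  then show ?thesis
    unfolding fun_eq_iff lhs_def S_def .
qed

end
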